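(* Let $A,B$ be finite-dimensional quantum systems of dimensions $d_A,d_B$ with fully degenerate local Hamiltonians, let $\rho=\rho^{AB}$ be a quantum state on $AB$, and let $\delta\ge 0$. Let $\sigma^*$ be a quantum state on $AB$ with positive partial transpose such that $$\mathrm{Tr}(\rho\sigma^* )\ \ge\ \max_{\sigma\in\mathrm{PPT}}\mathrm{Tr}(\rho\sigma)-\delta ,$$ and write the largest eigenvalue of $\sigma^*$ as $\lambda_{\max}(\sigma^* )=1-\varepsilon$. Then $$\mathrm{Tr}(\rho\sigma^* )+\delta\ \ge\ F_{\max}(\rho)\ \ge\ \mathrm{Tr}(\rho\sigma^* )-4\sqrt{\varepsilon}.$$
   Context: $\mathrm{PPT}$ is the set of quantum states (density matrices) on $AB$ whose partial transpose is positive semidefinite. For fully degenerate local Hamiltonians, $F_{\max}(\rho^{AB})=\max_{\Lambda\in\mathrm{GLOCC}}\langle 00|\Lambda[\rho^{AB}]|00\rangle$, where $\mathrm{GLOCC}$ is the set of LOCC (local operations and classical communication) protocols $\Lambda$ on $AB$ (with the same input and output space) satisfying $\Lambda[\mathbb{1}_{AB}/(d_Ad_B)]=\mathbb{1}_{AB}/(d_Ad_B)$, and $|00\rangle=|0\rangle^A\otimes|0\rangle^B$ is a fixed product of normalized state vectors (the local ground states). *)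

theory Defs
  imports
    "Jordan_Normal_Form.Schur_Decomposition"
    "Jordan_Normal_Form.Spectral_Radius"
begin

(* A system of dimension d is the space of vectors of length d over the complex numbers.  The
   basis vector |i>|j> of a bipartite system with local dimensions a, b has index i * b + j. *)

definition tensor_vec :: "complex vec \<Rightarrow> complex vec \<Rightarrow> complex vec" where
  "tensor_vec u v =
    vec (dim_vec u * dim_vec v) (\<lambda>i. u $ (i div dim_vec v) * v $ (i mod dim_vec v))"

definition tensor_mat :: "complex mat \<Rightarrow> complex mat \<Rightarrow> complex mat" where
  "tensor_mat M N = mat (dim_row M * dim_row N) (dim_col M * dim_col N)
    (\<lambda>(i, j). M $$ (i div dim_row N, j div dim_col N) * N $$ (i mod dim_row N, j mod dim_col N))"

definition mat_sum :: "nat \<Rightarrow> nat \<Rightarrow> ('i \<Rightarrow> complex mat) \<Rightarrow> 'i set \<Rightarrow> complex mat" where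
  "mat_sum r c f I = mat r c (\<lambda>(i, j). \<Sum>k\<in>I. f k $$ (i, j))"

(* The order on complex is that of Complex_Order: 0 \<le> z says that z is real and nonnegative.
   Hence positivity of the quadratic form entails that M is Hermitian. *)
definition pos_semidef :: "nat \<Rightarrow> complex mat \<Rightarrow> bool" where
  "pos_semidef n M \<longleftrightarrow>
    M \<in> carrier_mat n n \<and> (\<forall>v\<in>carrier_vec n. 0 \<le> (M *\<^sub>v v) \<bullet>c v)"

definition mat_trace :: "complex mat \<Rightarrow> complex" where
  "mat_trace M = (\<Sum>i<dim_row M. M $$ (i, i))"

definition density :: "nat \<Rightarrow> complex mat \<Rightarrow> bool" where
  "density n \<rho> \<longleftrightarrow> pos_semidef n \<rho> \<and> mat_trace \<rho> = 1"

(* Transposition of the second tensor factor. *)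
definition partial_transpose :: "nat \<Rightarrow> nat \<Rightarrow> complex mat \<Rightarrow> complex mat" where
  "partial_transpose a b M = mat (a * b) (a * b)
    (\<lambda>(i, j). M $$ ((i div b) * b + j mod b, (j div b) * b + i mod b))"

definition PPT :: "nat \<Rightarrow> nat \<Rightarrow> complex mat set" where
  "PPT a b = {\<sigma>. density (a * b) \<sigma> \<and> pos_semidef (a * b) (partial_transpose a b \<sigma>)}"

definition lambda_max :: "complex mat \<Rightarrow> real" where
  "lambda_max M = Max (Re ` spectrum M)"

(* The completely positive map X \<mapsto> \<Sum>k. K k X (K k)^* with m-dimensional output. *)
definition kraus_map :: "nat \<Rightarrow> complex mat list \<Rightarrow> complex mat \<Rightarrow> complex mat" where
  "kraus_map m Ks X = mat_sum m m (\<lambda>k. Ks ! k * X * mat_adjoint (Ks ! k)) {..<length Ks}"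

(* A quantum instrument on a d-dimensional system with outcomes i < n: outcome i is the completely
   positive map with Kraus operators Ks i and output dimension e i, and the sum of these maps
   preserves the trace. *)
definition instrument ::
    "nat \<Rightarrow> nat \<Rightarrow> (nat \<Rightarrow> nat) \<Rightarrow> (nat \<Rightarrow> complex mat list) \<Rightarrow> bool" where
  "instrument d n e Ks \<longleftrightarrow>
    (\<forall>i<n. set (Ks i) \<subseteq> carrier_mat (e i) d) \<and>
    mat_sum d d (\<lambda>i. mat_sum d d (\<lambda>k. mat_adjoint (Ks i ! k) * (Ks i ! k)) {..<length (Ks i)}) {..<n}
      = 1\<^sub>m d"

(* locc a' b' a b \<Lambda>: the channel \<Lambda> from a system with local dimensions a, b to one with
   local dimensions a', b' is implemented by an LOCC protocol with finitely many rounds.  In each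
   round one party applies a local instrument and announces the outcome i; the remaining protocol
   may depend on i.  The local dimensions may change during the protocol, which covers local
   ancillas. *)
inductive locc ::
    "nat \<Rightarrow> nat \<Rightarrow> nat \<Rightarrow> nat \<Rightarrow> (complex mat \<Rightarrow> complex mat) \<Rightarrow> bool" for a' b' where
  finish: "locc a' b' a' b' (\<lambda>X. X)"
| alice: "\<lbrakk>instrument a n e Ks; \<And>i. i < n \<Longrightarrow> locc a' b' (e i) b (\<Lambda> i)\<rbrakk> \<Longrightarrow>
    locc a' b' a b (\<lambda>X. mat_sum (a' * b') (a' * b')
      (\<lambda>i. \<Lambda> i (kraus_map (e i * b) (map (\<lambda>K. tensor_mat K (1\<^sub>m b)) (Ks i)) X)) {..<n})"
| bob: "\<lbrakk>instrument b n e Ks; \<And>i. i < n \<Longrightarrow> locc a' b' a (e i) (\<Lambda> i)\<rbrakk> \<Longrightarrow>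
    locc a' b' a b (\<lambda>X. mat_sum (a' * b') (a' * b')
      (\<lambda>i. \<Lambda> i (kraus_map (a * e i) (map (\<lambda>K. tensor_mat (1\<^sub>m a) K) (Ks i)) X)) {..<n})"

definition maximally_mixed :: "nat \<Rightarrow> complex mat" where
  "maximally_mixed n = (1 / of_nat n) \<cdot>\<^sub>m 1\<^sub>m n"

definition GLOCC :: "nat \<Rightarrow> nat \<Rightarrow> (complex mat \<Rightarrow> complex mat) set" where
  "GLOCC a b = {\<Lambda>. locc a b a b \<Lambda> \<and> \<Lambda> (maximally_mixed (a * b)) = maximally_mixed (a * b)}"

(* u and v are the local ground states.  Since the set of finite-round LOCC channels need not be
   closed, the maximum is taken as a supremum. *)
definition F_max :: "nat \<Rightarrow> nat \<Rightarrow> complex vec \<Rightarrow> complex vec \<Rightarrow> complex mat \<Rightarrow> real" where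
  "F_max a b u v \<rho> =
    (SUP \<Lambda>\<in>GLOCC a b. Re ((\<Lambda> \<rho> *\<^sub>v tensor_vec u v) \<bullet>c tensor_vec u v))"

end

theory Submission
  imports Defs "HOL-Analysis.L2_Norm"
begin

text \<open>Upper bound: the adjoint of a GLOCC channel maps the projector on the product of the ground
  states to a sum of positive product operators, and unitality makes its trace equal to one. So the
  fidelity of every GLOCC channel is the trace of $\rho$ times some PPT state.

  Lower bound: let $\psi$ be a unit eigenvector of $\sigma$ for the eigenvalue $1 - \varepsilon$. Since
  $\sigma$ is PPT, $\langle\psi, \sigma\psi\rangle$ is at most the largest squared overlap of $\psi$ with
  a product vector. Hence some product vector $\phi$ satisfies $\langle\phi, \sigma\phi\rangle \ge 1 - X^2$
  for any $X^2 > 2\varepsilon$, and then Tr$(\rho\sigma) \le \langle\phi, \rho\phi\rangle + 2X$. A product of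
  local unitaries is a GLOCC channel and attains the fidelity $\langle\phi, \rho\phi\rangle$. Letting
  $X \to \sqrt{2\varepsilon}$ gives the constant $2\sqrt 2 \le 4$.\<close>

section \<open>Positive semidefinite forms\<close>

text \<open>A state with a large eigenvalue need not be near a product vector; partial transposition
  is what forces it. The value <psi, sigma psi> does not change when both sigma and the projector on
  psi are partially transposed. The transposed sigma is still a density matrix, while the form of
  the transposed projector is at most the largest squared product overlap. The obstacle is
  attainment: \<open>F_max\<close> is a supremum, and a best product vector would call for a
  compactness or Schmidt argument. A strict inequality takes their place. If m < 1 - \<epsilon>
  bounded all product overlaps, it would bound <psi, sigma psi> = 1 - \<epsilon> as well, so some
  product vector exceeds m. The margin this requires is the gap between X^2 and 2\<epsilon>, closed
  only at the very end. Spectral decompositions are avoided too. A positive matrix is written as a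
  sum of rank-one terms by elimination, and the operator inequalities reduce to Cauchy-Schwarz on
  these terms.\<close>

lemma sum_lessThan_mult:
  fixes f :: "nat \<Rightarrow> 'a::comm_monoid_add"
  shows "(\<Sum>i<a * b. f i) = (\<Sum>x<a. \<Sum>y<b. f (x * b + y))"
proof -
  have "(\<Sum>i<a * b. f i) = (\<Sum>x<a. sum f {x * b..<x * b + b})"
    by (rule sum.nat_group[symmetric])
  also have "\<dots> = (\<Sum>x<a. \<Sum>y<b. f (x * b + y))"
  proof (rule sum.cong[OF refl])
    fix x
    show "sum f {x * b..<x * b + b} = (\<Sum>y<b. f (x * b + y))"
      using sum.shift_bounds_nat_ivl[of f 0 "x * b" b] by (simp add: atLeast0LessThan add.commute)
  qed
  finally show ?thesis .
qed

text \<open>Cauchy-Schwarz in bilinear form; conjugates are supplied through the choice of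
  \<open>f\<close>.\<close>

lemma cmod_sum_mult_le:
  "(cmod (\<Sum>i\<in>I. f i * g i))\<^sup>2 \<le> (\<Sum>i\<in>I. (cmod (f i))\<^sup>2) * (\<Sum>i\<in>I. (cmod (g i))\<^sup>2)"
proof -
  have "cmod (\<Sum>i\<in>I. f i * g i) \<le> (\<Sum>i\<in>I. cmod (f i) * cmod (g i))"
    by (rule order_trans[OF norm_sum]) (simp add: norm_mult)
  also have "\<dots> \<le> L2_set (\<lambda>i. cmod (f i)) I * L2_set (\<lambda>i. cmod (g i)) I"
    using L2_set_mult_ineq[of "\<lambda>i. cmod (f i)" "\<lambda>i. cmod (g i)" I] by simp
  finally have "(cmod (\<Sum>i\<in>I. f i * g i))\<^sup>2 \<le> (L2_set (\<lambda>i. cmod (f i)) I * L2_set (\<lambda>i. cmod (g i)) I)\<^sup>2"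
    by (rule power_mono) simp
  also have "\<dots> = (\<Sum>i\<in>I. (cmod (f i))\<^sup>2) * (\<Sum>i\<in>I. (cmod (g i))\<^sup>2)"
    by (simp add: L2_set_def power_mult_distrib sum_nonneg)
  finally show ?thesis .
qed

text \<open>An arbitrary index set allows induction by removing one index, which matrices of fixed
  dimension would make awkward. Only the values on \<open>I\<close> matter.\<close>

definition qform :: "'i set \<Rightarrow> ('i \<Rightarrow> 'i \<Rightarrow> complex) \<Rightarrow> ('i \<Rightarrow> complex) \<Rightarrow> complex" where
  "qform I M v = (\<Sum>i\<in>I. \<Sum>j\<in>I. M i j * v j * cnj (v i))"

lemma qform_insert:
  assumes "finite F" "x \<notin> F"
  shows "qform (insert x F) M v = M x x * v x * cnj (v x) + (\<Sum>j\<in>F. M x j * v j) * cnj (v x)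
    + v x * (\<Sum>i\<in>F. M i x * cnj (v i)) + qform F M v"
  using assms by (simp add: qform_def sum.distrib sum_distrib_left sum_distrib_right algebra_simps)

lemma qform_cong:
  "(\<And>i j. i \<in> I \<Longrightarrow> j \<in> I \<Longrightarrow> M i j = N i j) \<Longrightarrow> (\<And>i. i \<in> I \<Longrightarrow> v i = w i) \<Longrightarrow> qform I M v = qform I N w"
  unfolding qform_def by (intro sum.cong refl) auto

lemma qform_mono_neutral:
  assumes "finite I" "J \<subseteq> I" "\<And>i. i \<in> I - J \<Longrightarrow> v i = 0"
  shows "qform I M v = qform J M v"
proof -
  have "(\<Sum>j\<in>I. M i j * v j * cnj (v i)) = (\<Sum>j\<in>J. M i j * v j * cnj (v i))" for i
    by (rule sum.mono_neutral_right) (use assms in auto)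
  then have "qform I M v = (\<Sum>i\<in>I. \<Sum>j\<in>J. M i j * v j * cnj (v i))"
    by (simp add: qform_def)
  also have "\<dots> = qform J M v"
    unfolding qform_def by (rule sum.mono_neutral_right) (use assms in auto)
  finally show ?thesis .
qed

lemma qform_unit:
  assumes "finite I" "i \<in> I"
  shows "qform I M (\<lambda>k. if k = i then 1 else 0) = M i i"
  using assms by (subst qform_mono_neutral[of I "{i}"]) (auto simp: qform_def)

lemma qform_supp2:
  assumes "finite I" "i \<in> I" "j \<in> I" "i \<noteq> j"
  shows "qform I M (\<lambda>k. if k = i then s else if k = j then t else 0) =
    M i i * s * cnj s + M i j * t * cnj s + M j i * s * cnj t + M j j * t * cnj t"
  using assms by (subst qform_mono_neutral[of I "{i, j}"]) (auto simp: qform_def)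

text \<open>Polarization: the form is real at e_i, e_j, e_i + e_j and e_i + \<i> e_j, so both
  \<open>M i j + M j i\<close> and \<i> times \<open>M i j - M j i\<close> are real.\<close>

lemma psd_hermitian:
  assumes "finite I" "\<And>v. 0 \<le> qform I M v" "i \<in> I" "j \<in> I"
  shows "M j i = cnj (M i j)"
proof (cases "i = j")
  case True
  note qform_unit[OF assms(1,3), of M]
  with assms(2)[of "\<lambda>k. if k = i then 1 else 0"] True show ?thesis
    by (simp add: less_eq_complex_def complex_eq_iff)
next
  case False
  let ?q = "\<lambda>s t. M i i * s * cnj s + M i j * t * cnj s + M j i * s * cnj t + M j j * t * cnj t"
  have q: "0 \<le> ?q s t" for s t
    using assms(2) qform_supp2[OF assms(1,3,4) False, of M s t] by metis
  show ?thesis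
    using q[of 1 0] q[of 0 1] q[of 1 1] q[of 1 \<i>]
    by (simp add: less_eq_complex_def complex_eq_iff)
qed

lemma psd_diag_zero:
  assumes "finite I" "\<And>v. 0 \<le> qform I M v" "i \<in> I" "j \<in> I" "M i i = 0"
  shows "M i j = 0"
proof (rule ccontr)
  assume nz: "M i j \<noteq> 0"
  then have ne: "i \<noteq> j" using assms by auto
  let ?r = "Re (M j j)"
  \<comment> \<open>Scaled so that each of the two cross terms equals -(r + 1) with r the entry at
    (j, j). The form then takes the value -r - 2, which is negative.\<close>
  define s where "s = - of_real (?r + 1) * M i j / of_real ((cmod (M i j))\<^sup>2)"
  have q: "0 \<le> M i j * cnj s + M j i * s + M j j"
    using assms(2)[of "\<lambda>k. if k = i then s else if k = j then 1 else 0"]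
    unfolding qform_supp2[OF assms(1,3,4) ne] using assms(5) by simp
  have *: "M i j * cnj s = - of_real (?r + 1)"
    using nz by (simp add: s_def complex_norm_square field_simps del: of_real_power)
  have h: "M j i = cnj (M i j)" by (rule psd_hermitian[OF assms(1-4)])
  have "M j i * s = cnj (M i j * cnj s)" by (simp add: h)
  also have "\<dots> = - of_real (?r + 1)" unfolding * by simp
  finally have **: "M j i * s = - of_real (?r + 1)" .
  have d: "0 \<le> M j j"
    using assms(2)[of "\<lambda>k. if k = i then 0 else if k = j then 1 else 0"]
    unfolding qform_supp2[OF assms(1,3,4) ne] by simp
  show False using q d unfolding * ** by (simp add: less_eq_complex_def)
qed

text \<open>By induction on the index set: eliminating one index leaves the Schur complement, whose
  positivity is seen by extending a vector so that it minimizes the form in the eliminated coordinate.\<close>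

lemma psd_factor_finite:
  assumes "finite I" "\<And>v. 0 \<le> qform I M v"
  shows "\<exists>S. \<forall>i\<in>I. \<forall>j\<in>I. M i j = (\<Sum>k\<in>I. S k i * cnj (S k j))"
  using assms
proof (induction I arbitrary: M rule: finite_induct)
  case empty
  then show ?case by simp
next
  case (insert x F)
  let ?I = "insert x F"
  have fin: "finite ?I" using insert by simp
  have herm: "M j i = cnj (M i j)" if "i \<in> ?I" "j \<in> ?I" for i j
    by (rule psd_hermitian[OF fin insert.prems that])
  define p where "p = M x x"
  have p: "0 \<le> p"
    using insert.prems qform_unit[OF fin, of x M] unfolding p_def by (metis insertI1)
  show ?case
  proof (cases "p = 0")
    case True
    \<comment> \<open>A vanishing pivot forces its whole row and column to vanish, so the
      factorization on \<open>F\<close> only has to be extended by zero.\<close>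
    have z: "M x i = 0" "M i x = 0" if "i \<in> ?I" for i
      using psd_diag_zero[OF fin insert.prems _ that, of x] herm[of x i] that True p_def by auto
    have "0 \<le> qform F M v" for v
      using insert.prems[of v] insert.hyps z by (simp add: qform_insert)
    from insert.IH[OF this] obtain S where S: "\<forall>i\<in>F. \<forall>j\<in>F. M i j = (\<Sum>k\<in>F. S k i * cnj (S k j))" by blast
    have "M i j = (\<Sum>k\<in>?I. (if k = x \<or> i = x then 0 else S k i) * cnj (if k = x \<or> j = x then 0 else S k j))"
      if "i \<in> ?I" "j \<in> ?I" for i j
    proof (cases "i = x \<or> j = x")
      case True
      then show ?thesis using z that by (auto intro!: sum.neutral[symmetric])
    next
      case False
      then have "M i j = (\<Sum>k\<in>F. S k i * cnj (S k j))" using S that by auto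
      also have "\<dots> = (\<Sum>k\<in>F. (if k = x \<or> i = x then 0 else S k i) * cnj (if k = x \<or> j = x then 0 else S k j))"
        using insert.hyps False by (intro sum.cong) auto
      finally show ?thesis using insert.hyps by simp
    qed
    then show ?thesis by (intro exI[of _ "\<lambda>k i. if k = x \<or> i = x then 0 else S k i"]) blast
  next
    case False
    define r where "r = sqrt (Re p)"
    have pr: "p = of_real r * of_real r" "r > 0" "cnj p = p"
      using p False by (auto simp: r_def less_eq_complex_def complex_eq_iff)
    define N where "N i j = M i j - M i x * M x j / p" for i j
    have "0 \<le> qform F N v" for v
    proof -
      define c where "c = (\<Sum>j\<in>F. M x j * v j)"
      define w where "w i = (if i = x then - c / p else v i)" for i
      have wv: "w i = v i" if "i \<in> F" for i using that insert.hyps by (auto simp: w_def)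
      have c': "(\<Sum>i\<in>F. M i x * cnj (v i)) = cnj c"
          unfolding c_def cnj_sum by (rule sum.cong) (auto simp: herm[of x])
      have "qform F M w = qform F M v"
        by (rule qform_cong) (simp_all add: wv)
      moreover have "(\<Sum>j\<in>F. M x j * w j) = c"
        unfolding c_def by (rule sum.cong) (simp_all add: wv)
      moreover have "(\<Sum>i\<in>F. M i x * cnj (w i)) = cnj c"
        unfolding c'[symmetric] by (rule sum.cong) (simp_all add: wv)
      ultimately have "qform ?I M w = M x x * w x * cnj (w x) + c * cnj (w x) + w x * cnj c + qform F M v"
        unfolding qform_insert[OF insert.hyps] by simp
      also have "\<dots> = qform F M v - cnj c * c / p"
        using False pr(3) by (simp add: w_def p_def[symmetric] mult.commute)
      also have "cnj c * c / p = (\<Sum>i\<in>F. \<Sum>j\<in>F. M i x * M x j / p * v j * cnj (v i))"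
        unfolding c'[symmetric] unfolding c_def sum_product sum_divide_distrib
        by (intro sum.cong refl) simp
      also have "qform F M v - \<dots> = qform F N v"
        by (simp add: qform_def N_def sum_subtractf algebra_simps)
      finally show ?thesis using insert.prems by metis
    qed
    from insert.IH[OF this] obtain S where S: "\<forall>i\<in>F. \<forall>j\<in>F. N i j = (\<Sum>k\<in>F. S k i * cnj (S k j))" by blast
    \<comment> \<open>The new factor, labelled \<open>x\<close>, is the pivot column divided by the
      root of the pivot. The old factors are set to zero at \<open>x\<close>, where the induction
      hypothesis leaves \<open>S\<close> unspecified.\<close>
    define T where "T k i = (if k = x then M i x / of_real r else if i = x then 0 else S k i)" for k i
    have "M i j = (\<Sum>k\<in>?I. T k i * cnj (T k j))" if "i \<in> ?I" "j \<in> ?I" for i j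
    proof -
      have a: "T x i * cnj (T x j) = M i x * M x j / p"
        using herm[of j x] that by (simp add: T_def pr(1))
      have b: "(\<Sum>k\<in>F. T k i * cnj (T k j)) = N i j"
      proof (cases "i = x \<or> j = x")
        case True
        then have "N i j = 0" using False by (auto simp: N_def p_def)
        moreover have "(\<Sum>k\<in>F. T k i * cnj (T k j)) = 0"
          using True insert.hyps by (intro sum.neutral) (auto simp: T_def)
        ultimately show ?thesis by simp
      next
        case False
        then have "N i j = (\<Sum>k\<in>F. S k i * cnj (S k j))" using S that by auto
        also have "\<dots> = (\<Sum>k\<in>F. T k i * cnj (T k j))"
          using insert.hyps False by (intro sum.cong) (auto simp: T_def)
        finally show ?thesis by simp
      qed
      show ?thesis using insert.hyps by (simp add: a b) (simp add: N_def)
    qed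
    then show ?thesis by blast
  qed
qed

section \<open>Rank-one factorizations of positive matrices\<close>

abbreviation norm2 :: "'i set \<Rightarrow> ('i \<Rightarrow> complex) \<Rightarrow> real" where
  "norm2 I v \<equiv> (\<Sum>i\<in>I. (cmod (v i))\<^sup>2)"

lemma cscalar_prod_qform:
  assumes "M \<in> carrier_mat n n" "v \<in> carrier_vec n"
  shows "(M *\<^sub>v v) \<bullet>c v = qform {..<n} (\<lambda>i j. M $$ (i, j)) (($) v)"
  using assms unfolding qform_def
  by (auto simp: scalar_prod_def sum_distrib_right atLeast0LessThan intro!: sum.cong)

lemma pos_semidef_qform:
  assumes "pos_semidef n M"
  shows "0 \<le> qform {..<n} (\<lambda>i j. M $$ (i, j)) v"
proof -
  have "qform {..<n} (\<lambda>i j. M $$ (i, j)) (($) (vec n v)) = qform {..<n} (\<lambda>i j. M $$ (i, j)) v"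
    by (rule qform_cong) auto
  moreover have "0 \<le> qform {..<n} (\<lambda>i j. M $$ (i, j)) (($) (vec n v))"
  proof -
    have "M \<in> carrier_mat n n" "0 \<le> (M *\<^sub>v vec n v) \<bullet>c vec n v"
      using assms vec_carrier[of n v] unfolding pos_semidef_def by blast+
    then show ?thesis using cscalar_prod_qform[of M n "vec n v"] by (metis vec_carrier)
  qed
  ultimately show ?thesis by simp
qed

lemma pos_semidef_factor:
  assumes "pos_semidef n M"
  obtains S where "\<And>i j. i < n \<Longrightarrow> j < n \<Longrightarrow> M $$ (i, j) = (\<Sum>k<n. S k i * cnj (S k j))"
  using psd_factor_finite[OF finite_lessThan, of n "\<lambda>i j. M $$ (i, j)"] pos_semidef_qform[OF assms]
  by auto

text \<open>With inner products antilinear in the first slot, this is <w, M v> as the sum over k of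
  <w, S_k><S_k, v>. It opens the sesquilinear form to Cauchy-Schwarz, not just its diagonal
  values.\<close>

lemma bilinear_factor:
  assumes "\<And>i j. i \<in> I \<Longrightarrow> j \<in> I \<Longrightarrow> M i j = (\<Sum>k\<in>K. S k i * cnj (S k j))"
  shows "(\<Sum>i\<in>I. \<Sum>j\<in>I. M i j * v j * cnj (w i)) =
    (\<Sum>k\<in>K. cnj (\<Sum>i\<in>I. cnj (S k i) * w i) * (\<Sum>i\<in>I. cnj (S k i) * v i))"
proof -
  have "(\<Sum>i\<in>I. \<Sum>j\<in>I. M i j * v j * cnj (w i)) =
    (\<Sum>i\<in>I. \<Sum>j\<in>I. \<Sum>k\<in>K. S k i * cnj (w i) * (cnj (S k j) * v j))"
    using assms by (auto simp: sum_distrib_right sum_distrib_left mult_ac intro!: sum.cong)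
  also have "\<dots> = (\<Sum>i\<in>I. \<Sum>k\<in>K. \<Sum>j\<in>I. S k i * cnj (w i) * (cnj (S k j) * v j))"
    by (intro sum.cong refl sum.swap)
  also have "\<dots> = (\<Sum>k\<in>K. \<Sum>i\<in>I. \<Sum>j\<in>I. S k i * cnj (w i) * (cnj (S k j) * v j))"
    by (rule sum.swap)
  finally show ?thesis by (simp add: sum_product)
qed

lemma qform_factor:
  assumes "\<And>i j. i \<in> I \<Longrightarrow> j \<in> I \<Longrightarrow> M i j = (\<Sum>k\<in>K. S k i * cnj (S k j))"
  shows "qform I M v = of_real (norm2 K (\<lambda>k. \<Sum>i\<in>I. cnj (S k i) * v i))"
proof -
  have "complex_of_real (norm2 K (\<lambda>k. \<Sum>i\<in>I. cnj (S k i) * v i)) =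
      (\<Sum>k\<in>K. (\<Sum>i\<in>I. cnj (S k i) * v i) * cnj (\<Sum>i\<in>I. cnj (S k i) * v i))"
    unfolding of_real_sum complex_norm_square ..
  then show ?thesis
    unfolding qform_def using bilinear_factor[of I M S K v v, OF assms] by (simp only: mult.commute)
qed

lemma trace_factor:
  assumes "\<And>i j. i \<in> I \<Longrightarrow> j \<in> I \<Longrightarrow> M i j = (\<Sum>k\<in>K. S k i * cnj (S k j))"
  shows "(\<Sum>i\<in>I. M i i) = of_real (\<Sum>k\<in>K. norm2 I (S k))"
proof -
  have "(\<Sum>i\<in>I. M i i) = (\<Sum>i\<in>I. \<Sum>k\<in>K. S k i * cnj (S k i))"
    using assms by (intro sum.cong) auto
  also have "\<dots> = (\<Sum>k\<in>K. \<Sum>i\<in>I. S k i * cnj (S k i))" by (rule sum.swap)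
  finally show ?thesis unfolding of_real_sum complex_norm_square .
qed

lemma density_carrier: "density n \<rho> \<Longrightarrow> \<rho> \<in> carrier_mat n n"
  by (simp add: density_def pos_semidef_def)

text \<open>An ensemble of unnormalized pure states: the trace condition says that their squared
  norms, the weights, sum to one.\<close>

lemma density_factor:
  assumes "density n \<rho>"
  obtains S where "\<And>i j. i \<in> {..<n} \<Longrightarrow> j \<in> {..<n} \<Longrightarrow> \<rho> $$ (i, j) = (\<Sum>k<n. S k i * cnj (S k j))"
    and "(\<Sum>k<n. norm2 {..<n} (S k)) = 1"
proof -
  from assms have "pos_semidef n \<rho>" by (simp add: density_def)
  then obtain S where S: "\<And>i j. i < n \<Longrightarrow> j < n \<Longrightarrow> \<rho> $$ (i, j) = (\<Sum>k<n. S k i * cnj (S k j))"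
    by (rule pos_semidef_factor) blast
  have "(\<Sum>i<n. \<rho> $$ (i, i)) = 1"
    using assms density_carrier[OF assms] by (simp add: density_def mat_trace_def)
  with trace_factor[of "{..<n}" "\<lambda>i j. \<rho> $$ (i, j)" S "{..<n}"] S
  have "complex_of_real (\<Sum>k<n. norm2 {..<n} (S k)) = 1" by simp
  then have "(\<Sum>k<n. norm2 {..<n} (S k)) = 1" using of_real_eq_1_iff by blast
  with S show ?thesis by (intro that) auto
qed

text \<open>The operator inequality \<rho> \<le> 1 without eigenvalues: Cauchy-Schwarz for each
  factor, whose weights sum to one.\<close>

lemma density_qform_le:
  assumes "density n \<rho>"
  shows "Re (qform {..<n} (\<lambda>i j. \<rho> $$ (i, j)) v) \<le> norm2 {..<n} v"
proof -
  from density_factor[OF assms] obtain S where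
    S: "\<And>i j. i \<in> {..<n} \<Longrightarrow> j \<in> {..<n} \<Longrightarrow> \<rho> $$ (i, j) = (\<Sum>k<n. S k i * cnj (S k j))"
    and tr: "(\<Sum>k<n. norm2 {..<n} (S k)) = 1" by blast
  have "Re (qform {..<n} (\<lambda>i j. \<rho> $$ (i, j)) v) = norm2 {..<n} (\<lambda>k. \<Sum>i<n. cnj (S k i) * v i)"
    by (subst qform_factor[OF S]) auto
  also have "\<dots> \<le> (\<Sum>k<n. norm2 {..<n} (S k) * norm2 {..<n} v)"
    using cmod_sum_mult_le[of "\<lambda>i. cnj (S _ i)" v "{..<n}"] by (intro sum_mono) simp
  also have "\<dots> = norm2 {..<n} v" using tr by (simp flip: sum_distrib_right)
  finally show ?thesis .
qed

section \<open>The trace of a product of two states\<close>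

lemma trace_mult_factor:
  assumes "\<rho> \<in> carrier_mat n n" "\<sigma> \<in> carrier_mat n n"
    and S: "\<And>i j. i \<in> {..<n} \<Longrightarrow> j \<in> {..<n} \<Longrightarrow> \<sigma> $$ (i, j) = (\<Sum>k\<in>K. S k i * cnj (S k j))"
  shows "mat_trace (\<rho> * \<sigma>) = (\<Sum>k\<in>K. qform {..<n} (\<lambda>i j. \<rho> $$ (i, j)) (S k))"
proof -
  have "mat_trace (\<rho> * \<sigma>) = (\<Sum>i<n. \<Sum>j<n. \<Sum>k\<in>K. \<rho> $$ (i, j) * S k j * cnj (S k i))"
    using assms by (auto simp: mat_trace_def scalar_prod_def sum_distrib_left atLeast0LessThan mult_ac intro!: sum.cong)
  also have "\<dots> = (\<Sum>i<n. \<Sum>k\<in>K. \<Sum>j<n. \<rho> $$ (i, j) * S k j * cnj (S k i))"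
    by (intro sum.cong refl sum.swap)
  also have "\<dots> = (\<Sum>k\<in>K. \<Sum>i<n. \<Sum>j<n. \<rho> $$ (i, j) * S k j * cnj (S k i))"
    by (rule sum.swap)
  finally show ?thesis by (simp add: qform_def)
qed

lemma trace_mult_density_le_1:
  assumes "density n \<rho>" "density n \<sigma>"
  shows "Re (mat_trace (\<rho> * \<sigma>)) \<le> 1"
proof -
  from density_factor[OF assms(2)] obtain S where
    S: "\<And>i j. i \<in> {..<n} \<Longrightarrow> j \<in> {..<n} \<Longrightarrow> \<sigma> $$ (i, j) = (\<Sum>k<n. S k i * cnj (S k j))"
    and tr: "(\<Sum>k<n. norm2 {..<n} (S k)) = 1" by blast
  have "Re (mat_trace (\<rho> * \<sigma>)) = (\<Sum>k<n. Re (qform {..<n} (\<lambda>i j. \<rho> $$ (i, j)) (S k)))"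
    using trace_mult_factor[OF density_carrier[OF assms(1)] density_carrier[OF assms(2)] S] by simp
  also have "\<dots> \<le> (\<Sum>k<n. norm2 {..<n} (S k))"
    by (intro sum_mono density_qform_le assms)
  finally show ?thesis using tr by simp
qed

text \<open>The cross term is split by the arithmetic-geometric mean inequality with weight X. A
  small X puts the large coefficient on \<open>y\<close>, which will be the small component.\<close>

lemma cmod_add_sq_le:
  assumes "0 < X"
  shows "(cmod (x + y))\<^sup>2 \<le> (1 + X) * (cmod x)\<^sup>2 + (1 + 1 / X) * (cmod y)\<^sup>2"
proof -
  have "(cmod (x + y))\<^sup>2 \<le> (cmod x + cmod y)\<^sup>2"
    by (intro power_mono norm_triangle_ineq norm_ge_zero)
  moreover have "0 \<le> (X * cmod x - cmod y)\<^sup>2 / X" using assms by simp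
  then have "2 * cmod x * cmod y \<le> X * (cmod x)\<^sup>2 + (cmod y)\<^sup>2 / X"
    using assms by (simp add: power2_eq_square field_simps)
  ultimately show ?thesis by (simp add: power2_sum algebra_simps)
qed

text \<open>Pythagoras for the orthogonal projection onto the unit vector
  \<open>\<phi>\<close>.\<close>

lemma norm2_diff_proj:
  fixes \<phi> s :: "'i \<Rightarrow> complex"
  assumes "finite I" "norm2 I \<phi> = 1"
  defines "c \<equiv> \<Sum>i\<in>I. cnj (\<phi> i) * s i"
  shows "norm2 I (\<lambda>i. s i - c * \<phi> i) = norm2 I s - (cmod c)\<^sup>2"
proof -
  have c1: "(\<Sum>i\<in>I. cnj (s i) * \<phi> i) = cnj c" by (simp add: c_def mult.commute)
  have "complex_of_real (norm2 I \<phi>) = 1" using assms by simp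
  then have n: "(\<Sum>i\<in>I. \<phi> i * cnj (\<phi> i)) = 1" by (simp add: complex_norm_square del: of_real_power)
  have "complex_of_real (norm2 I (\<lambda>i. s i - c * \<phi> i)) =
    (\<Sum>i\<in>I. (s i - c * \<phi> i) * cnj (s i - c * \<phi> i))"
    unfolding of_real_sum complex_norm_square ..
  also have "\<dots> = (\<Sum>i\<in>I. s i * cnj (s i) - c * (cnj (s i) * \<phi> i) - cnj c * (cnj (\<phi> i) * s i)
      + c * cnj c * (\<phi> i * cnj (\<phi> i)))"
    by (intro sum.cong refl) (simp add: algebra_simps)
  also have "\<dots> = (\<Sum>i\<in>I. s i * cnj (s i)) - c * cnj c - cnj c * c + c * cnj c * 1"
    unfolding sum.distrib sum_subtractf sum_distrib_left[symmetric] n c1 c_def[symmetric] ..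
  also have "\<dots> = of_real (norm2 I s - (cmod c)\<^sup>2)"
    unfolding of_real_diff of_real_sum complex_norm_square by simp
  finally show ?thesis using of_real_eq_iff by blast
qed

text \<open>Here p stands for <phi, rho phi> and g for the weight of sigma orthogonal to phi. The
  left side is affine in g with nonnegative slope, so g may be raised to X^2. What remains is affine
  in p, with values X + X^2 at p = 0 and 1 + 2X - X^3 at p = 1.\<close>

lemma gentle_bound:
  assumes "0 < (X::real)" "X \<le> 1" "0 \<le> g" "g \<le> X\<^sup>2" "0 \<le> p" "p \<le> 1"
  shows "(1 + X) * ((1 - g) * p) + (1 + 1 / X) * g \<le> p + 2 * X"
proof -
  have "(1 + X) * p \<le> 1 + 1 / X"
  proof -
    have "(1 + X) * p \<le> 1 + X" using assms by (simp add: mult_left_le)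
    also have "X \<le> 1 / X" using assms by (simp add: field_simps mult_le_one)
    finally show ?thesis by simp
  qed
  then have "((1 + 1 / X) - (1 + X) * p) * g \<le> ((1 + 1 / X) - (1 + X) * p) * X\<^sup>2"
    using assms by (intro mult_left_mono) auto
  then have "(1 + X) * ((1 - g) * p) + (1 + 1 / X) * g \<le> (1 + X) * ((1 - X\<^sup>2) * p) + (1 + 1 / X) * X\<^sup>2"
    by (simp add: algebra_simps)
  also have "\<dots> = p + X + X\<^sup>2 + p * (X - X\<^sup>2 - X ^ 3)"
    using assms by (simp add: field_simps power2_eq_square power3_eq_cube)
  also have "\<dots> \<le> p + 2 * X"
  proof (cases "X - X\<^sup>2 - X ^ 3 \<le> 0")
    case True
    then have "p * (X - X\<^sup>2 - X ^ 3) \<le> 0" using assms by (simp add: mult_nonneg_nonpos)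
    moreover have "X\<^sup>2 \<le> X" using assms by (simp add: power2_eq_square)
    ultimately show ?thesis by simp
  next
    case False
    then have "p * (X - X\<^sup>2 - X ^ 3) \<le> X - X\<^sup>2 - X ^ 3" using assms by (intro mult_left_le_one_le) auto
    then show ?thesis using assms zero_le_power[of X 3] by linarith
  qed
  finally show ?thesis .
qed

text \<open>The factors of $\sigma$ are split along $\phi$; the square of a sum is bounded with weights
  $1 + X$ and $1 + 1 / X$, and the natural choice is $X^2 = 1 - \langle\phi,\sigma\phi\rangle$. Taking $X$ as a
  free positive number avoids dividing by zero when $\sigma$ is the projector on $\phi$.\<close>

lemma trace_mult_le_qform:
  assumes \<rho>: "density n \<rho>" and \<sigma>: "density n \<sigma>" and \<phi>: "norm2 {..<n} \<phi> = 1"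
    and X: "0 < X" and f: "1 - Re (qform {..<n} (\<lambda>i j. \<sigma> $$ (i, j)) \<phi>) \<le> X\<^sup>2"
  shows "Re (mat_trace (\<rho> * \<sigma>)) \<le> Re (qform {..<n} (\<lambda>i j. \<rho> $$ (i, j)) \<phi>) + 2 * X"
proof -
  let ?q = "\<lambda>v. Re (qform {..<n} (\<lambda>i j. \<rho> $$ (i, j)) v)"
  from density_factor[OF \<sigma>] obtain S where
    S: "\<And>i j. i \<in> {..<n} \<Longrightarrow> j \<in> {..<n} \<Longrightarrow> \<sigma> $$ (i, j) = (\<Sum>k<n. S k i * cnj (S k j))"
    and trS: "(\<Sum>k<n. norm2 {..<n} (S k)) = 1" by blast
  from density_factor[OF \<rho>] obtain R where
    R: "\<And>i j. i \<in> {..<n} \<Longrightarrow> j \<in> {..<n} \<Longrightarrow> \<rho> $$ (i, j) = (\<Sum>k<n. R k i * cnj (R k j))"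
    by blast
  have q: "?q v = norm2 {..<n} (\<lambda>l. \<Sum>i<n. cnj (R l i) * v i)" for v
    by (subst qform_factor[OF R]) auto
  have q0: "0 \<le> ?q v" for v unfolding q by (intro sum_nonneg) simp
  show ?thesis
  proof (cases "X \<le> 1")
    case False
    then show ?thesis using trace_mult_density_le_1[OF \<rho> \<sigma>] q0[of \<phi>] by linarith
  next
    case True
    \<comment> \<open>Each factor of sigma splits into \<open>c k\<close> times phi and a remainder
      \<open>t k\<close> orthogonal to phi. The remainders carry the total weight g = 1 - <phi,
      sigma phi>.\<close>
    define c where "c k = (\<Sum>i<n. cnj (\<phi> i) * S k i)" for k
    define t where "t k i = S k i - c k * \<phi> i" for k i
    define g where "g = (\<Sum>k<n. norm2 {..<n} (t k))"
    have t: "norm2 {..<n} (t k) = norm2 {..<n} (S k) - (cmod (c k))\<^sup>2" for k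
      using norm2_diff_proj[OF finite_lessThan \<phi>] by (simp add: t_def c_def)
    have "(cmod (\<Sum>i<n. cnj (S k i) * \<phi> i))\<^sup>2 = (cmod (c k))\<^sup>2" for k
    proof -
      have "(\<Sum>i<n. cnj (S k i) * \<phi> i) = cnj (c k)" by (simp add: c_def mult.commute)
      then show ?thesis by simp
    qed
    then have "Re (qform {..<n} (\<lambda>i j. \<sigma> $$ (i, j)) \<phi>) = norm2 {..<n} c"
      by (subst qform_factor[OF S]) auto
    with f have g: "g \<le> X\<^sup>2" and c: "norm2 {..<n} c = 1 - g"
      using trS by (auto simp: g_def t sum_subtractf)
    have g0: "0 \<le> g" unfolding g_def by (intro sum_nonneg) simp
    have "?q (S k) \<le> (1 + X) * ((cmod (c k))\<^sup>2 * ?q \<phi>) + (1 + 1 / X) * ?q (t k)" for k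
    proof -
      have "(\<Sum>i<n. cnj (R l i) * S k i) = c k * (\<Sum>i<n. cnj (R l i) * \<phi> i) + (\<Sum>i<n. cnj (R l i) * t k i)" for l
        by (simp add: t_def sum_distrib_left sum.distrib[symmetric] algebra_simps)
      then have "?q (S k) \<le> (\<Sum>l<n. (1 + X) * (cmod (c k * (\<Sum>i<n. cnj (R l i) * \<phi> i)))\<^sup>2
          + (1 + 1 / X) * (cmod (\<Sum>i<n. cnj (R l i) * t k i))\<^sup>2)"
        unfolding q by (intro sum_mono) (simp add: cmod_add_sq_le[OF X] del: mult_cancel_left)
      also have "\<dots> = (1 + X) * ((cmod (c k))\<^sup>2 * ?q \<phi>) + (1 + 1 / X) * ?q (t k)"
        by (simp only: q norm_mult power_mult_distrib sum.distrib sum_distrib_left[symmetric])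
      finally show ?thesis .
    qed
    \<comment> \<open>The crude bound \<rho> \<le> 1 is spent only on the light remainder; along phi
      the exact value of the form is kept.\<close>
    also have "(1 + X) * ((cmod (c k))\<^sup>2 * ?q \<phi>) + (1 + 1 / X) * ?q (t k) \<le>
        (1 + X) * ((cmod (c k))\<^sup>2 * ?q \<phi>) + (1 + 1 / X) * norm2 {..<n} (t k)" for k
      using X by (intro add_left_mono mult_left_mono density_qform_le[OF \<rho>]) simp
    finally have qS: "?q (S k) \<le> (1 + X) * ((cmod (c k))\<^sup>2 * ?q \<phi>) + (1 + 1 / X) * norm2 {..<n} (t k)" for k .
    have "Re (mat_trace (\<rho> * \<sigma>)) = (\<Sum>k<n. ?q (S k))"
      using trace_mult_factor[OF density_carrier[OF \<rho>] density_carrier[OF \<sigma>] S] by simp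
    also have "\<dots> \<le> (\<Sum>k<n. (1 + X) * ((cmod (c k))\<^sup>2 * ?q \<phi>) + (1 + 1 / X) * norm2 {..<n} (t k))"
      by (intro sum_mono qS)
    also have "\<dots> = (1 + X) * (norm2 {..<n} c * ?q \<phi>) + (1 + 1 / X) * g"
      unfolding g_def sum.distrib sum_distrib_left[symmetric] sum_distrib_right[symmetric] ..
    also have "\<dots> \<le> ?q \<phi> + 2 * X"
      unfolding c using \<phi> by (intro gentle_bound X True g0 g q0 order_trans[OF density_qform_le[OF \<rho>]]) simp
    finally show ?thesis .
  qed
qed

section \<open>Product vectors and positive partial transpose\<close>

text \<open>In the target order \<open>l\<close> and \<open>j\<close> are innermost, where the
  summand will split into a product of a sum over \<open>l\<close> and one over
  \<open>j\<close>.\<close>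

lemma ppt_reorder:
  fixes F :: "nat \<Rightarrow> nat \<Rightarrow> nat \<Rightarrow> nat \<Rightarrow> nat \<Rightarrow> complex"
  shows "(\<Sum>i<a. \<Sum>j<b. \<Sum>k<a. \<Sum>l<b. \<Sum>x<n. F i j k l x) = (\<Sum>x<n. \<Sum>i<a. \<Sum>k<a. \<Sum>l<b. \<Sum>j<b. F i j k l x)"
proof -
  have 1: "(\<Sum>k<a. \<Sum>l<b. \<Sum>x<n. F i j k l x) = (\<Sum>x<n. \<Sum>k<a. \<Sum>l<b. F i j k l x)" for i j
  proof -
    have "(\<Sum>k<a. \<Sum>l<b. \<Sum>x<n. F i j k l x) = (\<Sum>k<a. \<Sum>x<n. \<Sum>l<b. F i j k l x)"
      by (intro sum.cong refl sum.swap)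
    also have "\<dots> = (\<Sum>x<n. \<Sum>k<a. \<Sum>l<b. F i j k l x)" by (rule sum.swap)
    finally show ?thesis .
  qed
  have 2: "(\<Sum>j<b. \<Sum>k<a. \<Sum>l<b. F i j k l x) = (\<Sum>k<a. \<Sum>l<b. \<Sum>j<b. F i j k l x)" for i x
  proof -
    have "(\<Sum>j<b. \<Sum>k<a. \<Sum>l<b. F i j k l x) = (\<Sum>k<a. \<Sum>j<b. \<Sum>l<b. F i j k l x)"
      by (rule sum.swap)
    also have "\<dots> = (\<Sum>k<a. \<Sum>l<b. \<Sum>j<b. F i j k l x)" by (intro sum.cong refl sum.swap)
    finally show ?thesis .
  qed
  have "(\<Sum>i<a. \<Sum>j<b. \<Sum>x<n. \<Sum>k<a. \<Sum>l<b. F i j k l x) = (\<Sum>i<a. \<Sum>x<n. \<Sum>j<b. \<Sum>k<a. \<Sum>l<b. F i j k l x)"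
    by (intro sum.cong refl sum.swap)
  also have "\<dots> = (\<Sum>x<n. \<Sum>i<a. \<Sum>j<b. \<Sum>k<a. \<Sum>l<b. F i j k l x)" by (rule sum.swap)
  finally show ?thesis unfolding 1 2 .
qed

text \<open>The left side is the real part of the trace of N times its entrywise conjugate.
  Termwise, Re(z cnj w) is at most the mean of the two squared moduli, and exchanging the indices
  does not change the total of the squares.\<close>

lemma Re_sum_mult_cnj_swap_le:
  fixes N :: "'i \<Rightarrow> 'i \<Rightarrow> complex"
  shows "Re (\<Sum>i\<in>I. \<Sum>k\<in>I. N i k * cnj (N k i)) \<le> (\<Sum>i\<in>I. norm2 I (N i))"
proof -
  have "Re (z * cnj w) \<le> ((cmod z)\<^sup>2 + (cmod w)\<^sup>2) / 2" for z w
  proof -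
    have "0 \<le> (cmod (z - w))\<^sup>2" by simp
    then show ?thesis unfolding cmod_power2 by (simp add: power2_eq_square algebra_simps)
  qed
  then have "Re (\<Sum>i\<in>I. \<Sum>k\<in>I. N i k * cnj (N k i)) \<le>
      (\<Sum>i\<in>I. \<Sum>k\<in>I. ((cmod (N i k))\<^sup>2 + (cmod (N k i))\<^sup>2) / 2)"
    unfolding Re_sum by (intro sum_mono)
  also have "\<dots> = ((\<Sum>i\<in>I. norm2 I (N i)) + (\<Sum>i\<in>I. \<Sum>k\<in>I. (cmod (N k i))\<^sup>2)) / 2"
    by (simp add: sum.distrib sum_divide_distrib add_divide_distrib)
  also have "(\<Sum>i\<in>I. \<Sum>k\<in>I. (cmod (N k i))\<^sup>2) = (\<Sum>i\<in>I. norm2 I (N i))"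
    by (rule sum.swap)
  finally show ?thesis by simp
qed

lemma index_lt: "i < a \<Longrightarrow> j < b \<Longrightarrow> i * b + j < a * (b::nat)"
proof -
  assume "i < a" "j < b"
  then have "i * b + j < i * b + b" by simp
  also have "\<dots> = (i + 1) * b" by simp
  also have "\<dots> \<le> a * b" using \<open>i < a\<close> by (intro mult_le_mono1) simp
  finally show ?thesis .
qed

text \<open>Function counterpart of \<open>tensor_vec\<close>, in the shape that
  \<open>qform\<close> and \<open>norm2\<close> take.\<close>

definition product_vec :: "nat \<Rightarrow> (nat \<Rightarrow> complex) \<Rightarrow> (nat \<Rightarrow> complex) \<Rightarrow> nat \<Rightarrow> complex" where
  "product_vec b u w i = u (i div b) * w (i mod b)"

lemma product_vec_index [simp]: "j < b \<Longrightarrow> product_vec b u w (i * b + j) = u i * w j"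
  by (simp add: product_vec_def)

lemma norm2_product_vec:
  "norm2 {..<a * b} (product_vec b u w) = norm2 {..<a} u * norm2 {..<b} w"
  by (simp add: sum_lessThan_mult norm_mult power_mult_distrib sum_product)

text \<open>If $C$ is the matrix of $\psi$ and $x$ is reshaped into a matrix $Y$, then the partial transpose of
  the projector on $\psi$ takes the value Tr $M \overline M \le \|M\|_2^2$ at $x$, where $M = Y C^T$, and
  $\|M\|_2 \le \|C\| \|Y\|_2$. The hypothesis bounds $\|C\|^2$ by $m$.\<close>

lemma ppt_product_overlap:
  assumes \<sigma>: "\<sigma> \<in> PPT a b" and m: "0 \<le> m"
    and ov: "\<And>u w. (cmod (\<Sum>i<a * b. cnj (product_vec b u w i) * \<psi> i))\<^sup>2 \<le> m * (norm2 {..<a} u * norm2 {..<b} w)"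
  shows "Re (qform {..<a * b} (\<lambda>i j. \<sigma> $$ (i, j)) \<psi>) \<le> m"
proof -
  let ?n = "a * b"
  define P where "P = partial_transpose a b \<sigma>"
  have "density ?n \<sigma>" "pos_semidef ?n P" using \<sigma> by (auto simp: PPT_def P_def)
  note \<sigma>c = density_carrier[OF \<open>density ?n \<sigma>\<close>]
  have P: "P $$ (i * b + j, k * b + l) = \<sigma> $$ (i * b + l, k * b + j)"
    if "i < a" "j < b" "k < a" "l < b" for i j k l
    using that by (simp add: P_def partial_transpose_def index_lt)
  have Pii: "P $$ (i, i) = \<sigma> $$ (i, i)" if "i < ?n" for i
    using that by (simp add: P_def partial_transpose_def)
  \<comment> \<open>Partial transposition fixes the diagonal, hence the trace; positivity is the PPT
    condition. So \<open>P\<close> has its own ensemble, and \<open>R\<close> refers to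
    \<open>P\<close> and not to \<sigma>.\<close>
  have dens: "density ?n P"
    using \<open>density ?n \<sigma>\<close> \<open>pos_semidef ?n P\<close> \<sigma>c Pii
    by (auto simp: density_def pos_semidef_def mat_trace_def)
  from density_factor[OF this] obtain R where
    R: "\<And>i j. i \<in> {..<?n} \<Longrightarrow> j \<in> {..<?n} \<Longrightarrow> P $$ (i, j) = (\<Sum>k<?n. R k i * cnj (R k j))"
    and tr: "(\<Sum>k<?n. norm2 {..<?n} (R k)) = 1" by blast
  define N where "N x i k = (\<Sum>l<b. R x (i * b + l) * \<psi> (k * b + l))" for x i k
  have "qform {..<?n} (\<lambda>i j. \<sigma> $$ (i, j)) \<psi> = (\<Sum>i<a. \<Sum>j<b. \<Sum>k<a. \<Sum>l<b.
      \<sigma> $$ (i * b + j, k * b + l) * \<psi> (k * b + l) * cnj (\<psi> (i * b + j)))"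
    unfolding qform_def sum_lessThan_mult ..
  also have "\<dots> = (\<Sum>i<a. \<Sum>j<b. \<Sum>k<a. \<Sum>l<b. \<Sum>x<?n.
      R x (i * b + l) * \<psi> (k * b + l) * cnj (R x (k * b + j) * \<psi> (i * b + j)))"
  proof (intro sum.cong refl, goal_cases)
    case (1 i j k l)
    then have "\<sigma> $$ (i * b + j, k * b + l) = (\<Sum>x<?n. R x (i * b + l) * cnj (R x (k * b + j)))"
      using P[of i l k j] R[of "i * b + l" "k * b + j"] by (simp add: index_lt)
    then show ?case by (simp add: sum_distrib_right sum_distrib_left mult_ac)
  qed
  also have "\<dots> = (\<Sum>x<?n. \<Sum>i<a. \<Sum>k<a. \<Sum>l<b. \<Sum>j<b.
      R x (i * b + l) * \<psi> (k * b + l) * cnj (R x (k * b + j) * \<psi> (i * b + j)))"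
    by (rule ppt_reorder)
  also have "\<dots> = (\<Sum>x<?n. \<Sum>i<a. \<Sum>k<a. N x i k * cnj (N x k i))"
    unfolding N_def cnj_sum sum_product ..
  finally have "Re (qform {..<?n} (\<lambda>i j. \<sigma> $$ (i, j)) \<psi>) =
      (\<Sum>x<?n. Re (\<Sum>i<a. \<Sum>k<a. N x i k * cnj (N x k i)))"
    by simp
  also have "\<dots> \<le> (\<Sum>x<?n. \<Sum>i<a. norm2 {..<a} (N x i))"
    by (intro sum_mono Re_sum_mult_cnj_swap_le)
  also have "\<dots> \<le> (\<Sum>x<?n. \<Sum>i<a. m * (\<Sum>l<b. (cmod (R x (i * b + l)))\<^sup>2))"
  proof (intro sum_mono)
    fix x i
    let ?r = "\<lambda>l. R x (i * b + l)" and ?s = "norm2 {..<a} (N x i)"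
    \<comment> \<open>The overlap hypothesis is tested on row \<open>i\<close> of \<open>N x\<close>
      tensored with the conjugate of the block \<open>?r\<close>. This overlap is exactly the
      squared norm \<open>?s\<close> of that row, so the hypothesis is quadratic in
      \<open>?s\<close> on the left, linear on the right, and one factor cancels.\<close>
    have "(\<Sum>p<?n. cnj (product_vec b (N x i) (\<lambda>l. cnj (?r l)) p) * \<psi> p) =
        (\<Sum>k<a. \<Sum>l<b. cnj (N x i k) * (?r l * \<psi> (k * b + l)))"
      by (simp add: sum_lessThan_mult mult.assoc)
    also have "\<dots> = (\<Sum>k<a. cnj (N x i k) * N x i k)"
      unfolding sum_distrib_left[symmetric] N_def[symmetric] ..
    also have "\<dots> = of_real ?s"
      unfolding of_real_sum complex_norm_square by (simp add: mult.commute)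
    finally have "(cmod (complex_of_real ?s))\<^sup>2 \<le> m * (?s * norm2 {..<b} ?r)"
      using ov[of "N x i" "\<lambda>l. cnj (?r l)"] by simp
    then have "?s * ?s \<le> ?s * (m * norm2 {..<b} ?r)"
      by (simp only: norm_of_real power2_abs) (simp add: power2_eq_square mult_ac)
    moreover have "0 \<le> ?s" "0 \<le> m * norm2 {..<b} ?r" using m by (auto intro!: sum_nonneg mult_nonneg_nonneg)
    ultimately show "?s \<le> m * norm2 {..<b} ?r"
      by (cases "?s = 0") (auto simp: mult_le_cancel_left)
  qed
  also have "\<dots> = m * (\<Sum>x<?n. norm2 {..<?n} (R x))"
    unfolding sum_distrib_left[symmetric] sum_lessThan_mult ..
  finally show ?thesis using tr by simp
qed

section \<open>The top eigenvector of a state\<close>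

text \<open>An eigenvalue equals the form at its unit eigenvector and is therefore real. This
  matters because \<open>lambda_max\<close> is a maximum of real parts: that real part must itself
  be an eigenvalue.\<close>

lemma density_eigenvalue_real:
  assumes \<sigma>: "density n \<sigma>" and \<psi>: "norm2 {..<n} \<psi> = 1"
    and ev: "\<And>i. i < n \<Longrightarrow> (\<Sum>j<n. \<sigma> $$ (i, j) * \<psi> j) = z * \<psi> i"
  shows "qform {..<n} (\<lambda>i j. \<sigma> $$ (i, j)) \<psi> = z" and "z = of_real (Re z)"
proof -
  have "qform {..<n} (\<lambda>i j. \<sigma> $$ (i, j)) \<psi> = (\<Sum>i<n. z * (\<psi> i * cnj (\<psi> i)))"
    unfolding qform_def sum_distrib_right[symmetric] by (intro sum.cong refl) (simp add: ev)
  also have "\<dots> = z * of_real (norm2 {..<n} \<psi>)"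
    unfolding of_real_sum complex_norm_square sum_distrib_left ..
  finally show q: "qform {..<n} (\<lambda>i j. \<sigma> $$ (i, j)) \<psi> = z" using \<psi> by simp
  have "0 \<le> qform {..<n} (\<lambda>i j. \<sigma> $$ (i, j)) \<psi>"
    using \<sigma> by (auto simp: density_def intro: pos_semidef_qform)
  then show "z = of_real (Re z)" unfolding q by (simp add: less_eq_complex_def complex_eq_iff)
qed

lemma lambda_max_eigenvector:
  assumes \<sigma>: "density n \<sigma>" and n: "0 < n"
  obtains \<psi> where "norm2 {..<n} \<psi> = 1"
    and "\<And>i. i < n \<Longrightarrow> (\<Sum>j<n. \<sigma> $$ (i, j) * \<psi> j) = of_real (lambda_max \<sigma>) * \<psi> i"
proof -
  note c = density_carrier[OF \<sigma>]
  have "Max (Re ` spectrum \<sigma>) \<in> Re ` spectrum \<sigma>"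
    using card_finite_spectrum(1)[OF c] spectrum_non_empty[OF c n] by (intro Max_in) auto
  then obtain z where z: "eigenvalue \<sigma> z" "Re z = lambda_max \<sigma>"
    by (auto simp: spectrum_def lambda_max_def)
  then obtain v where v: "v \<in> carrier_vec n" "v \<noteq> 0\<^sub>v n" "\<sigma> *\<^sub>v v = z \<cdot>\<^sub>v v"
    using c by (auto simp: eigenvalue_def eigenvector_def)
  define s where "s = norm2 {..<n} (($) v)"
  have "s \<noteq> 0"
  proof
    assume "s = 0"
    then have "\<forall>i<n. v $ i = 0" unfolding s_def by (subst (asm) sum_nonneg_eq_0_iff) auto
    then have "v = 0\<^sub>v n" using v by auto
    with v show False by simp
  qed
  moreover have "0 \<le> s" unfolding s_def by (intro sum_nonneg) simp
  ultimately have s: "0 < s" by simp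
  define \<psi> where "\<psi> i = v $ i / of_real (sqrt s)" for i
  have 1: "norm2 {..<n} \<psi> = 1"
    using s by (simp add: \<psi>_def norm_divide power_divide flip: sum_divide_distrib) (simp add: s_def)
  have 2: "(\<Sum>j<n. \<sigma> $$ (i, j) * \<psi> j) = z * \<psi> i" if "i < n" for i
  proof -
    have "(\<Sum>j<n. \<sigma> $$ (i, j) * v $ j) = z * v $ i"
      using arg_cong[OF v(3), of "\<lambda>w. w $ i"] that c v(1)
      by (auto simp: scalar_prod_def atLeast0LessThan)
    then show ?thesis by (simp add: \<psi>_def flip: sum_divide_distrib)
  qed
  from density_eigenvalue_real(2)[OF \<sigma> 1 2] z(2) have "z = of_real (lambda_max \<sigma>)" by simp
  with 1 2 that show ?thesis by blast
qed

lemma lambda_max_le_1: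
  assumes \<sigma>: "density n \<sigma>" and n: "0 < n"
  shows "lambda_max \<sigma> \<le> 1"
proof -
  obtain \<psi> where \<psi>: "norm2 {..<n} \<psi> = 1"
    and ev: "\<And>i. i < n \<Longrightarrow> (\<Sum>j<n. \<sigma> $$ (i, j) * \<psi> j) = of_real (lambda_max \<sigma>) * \<psi> i"
    using lambda_max_eigenvector[OF \<sigma> n] by blast
  show ?thesis
    using density_qform_le[OF \<sigma>, of \<psi>] density_eigenvalue_real(1)[OF \<sigma> \<psi> ev] \<psi> by simp
qed

text \<open>This says that \<sigma> dominates \<open>l\<close> times the projector on psi.
  Cauchy-Schwarz for the form of \<sigma> gives |<phi, sigma psi>|^2 \<le> <phi, sigma phi><psi,
  sigma psi>; the left side is l^2 times the squared overlap, the last factor is l, and one l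
  cancels.\<close>

lemma density_qform_ge_eigen:
  assumes \<sigma>: "density n \<sigma>" and \<psi>: "norm2 {..<n} \<psi> = 1" and l: "0 < l"
    and ev: "\<And>i. i < n \<Longrightarrow> (\<Sum>j<n. \<sigma> $$ (i, j) * \<psi> j) = of_real l * \<psi> i"
  shows "l * (cmod (\<Sum>i<n. cnj (\<phi> i) * \<psi> i))\<^sup>2 \<le> Re (qform {..<n} (\<lambda>i j. \<sigma> $$ (i, j)) \<phi>)"
proof -
  let ?c = "\<Sum>i<n. cnj (\<phi> i) * \<psi> i"
  from density_factor[OF \<sigma>] obtain S where
    S: "\<And>i j. i \<in> {..<n} \<Longrightarrow> j \<in> {..<n} \<Longrightarrow> \<sigma> $$ (i, j) = (\<Sum>k<n. S k i * cnj (S k j))" by blast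
  let ?p = "\<lambda>v k. \<Sum>i<n. cnj (S k i) * v i"
  have q: "Re (qform {..<n} (\<lambda>i j. \<sigma> $$ (i, j)) v) = norm2 {..<n} (?p v)" for v
    by (subst qform_factor[OF S]) auto
  have "of_real l * ?c = (\<Sum>i<n. \<Sum>j<n. \<sigma> $$ (i, j) * \<psi> j * cnj (\<phi> i))"
    unfolding sum_distrib_right[symmetric] sum_distrib_left by (intro sum.cong refl) (subst ev, auto simp: mult_ac)
  also have "\<dots> = (\<Sum>k<n. cnj (?p \<phi> k) * ?p \<psi> k)"
    by (rule bilinear_factor[OF S]) auto
  finally have "(cmod (of_real l * ?c))\<^sup>2 \<le> norm2 {..<n} (\<lambda>k. cnj (?p \<phi> k)) * norm2 {..<n} (?p \<psi>)"
    using cmod_sum_mult_le[of "\<lambda>k. cnj (?p \<phi> k)" "?p \<psi>" "{..<n}"] by simp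
  also have "\<dots> = norm2 {..<n} (?p \<phi>) * l"
    using q[of \<psi>] density_eigenvalue_real(1)[OF \<sigma> \<psi> ev] by (simp del: cnj_sum)
  finally have "l * (l * (cmod ?c)\<^sup>2) \<le> l * Re (qform {..<n} (\<lambda>i j. \<sigma> $$ (i, j)) \<phi>)"
    unfolding q norm_mult power_mult_distrib using l by (simp add: power2_eq_square mult_ac)
  then show ?thesis using l by simp
qed

text \<open>Choosing the product vector near the largest Schmidt coefficient of the top eigenvector loses
  $\varepsilon$ twice: once for the eigenvalue and once for the overlap.\<close>

lemma ppt_product_fidelity:
  assumes \<sigma>: "\<sigma> \<in> PPT a b" and ab: "0 < a * b" and lm: "lambda_max \<sigma> = 1 - \<epsilon>"
    and X: "2 * \<epsilon> < X\<^sup>2" "X\<^sup>2 \<le> 1"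
  obtains u w where "norm2 {..<a} u = 1" and "norm2 {..<b} w = 1"
    and "1 - Re (qform {..<a * b} (\<lambda>i j. \<sigma> $$ (i, j)) (product_vec b u w)) \<le> X\<^sup>2"
proof -
  let ?n = "a * b"
  have d: "density ?n \<sigma>" using \<sigma> by (simp add: PPT_def)
  obtain \<psi> where \<psi>: "norm2 {..<?n} \<psi> = 1"
    and ev: "\<And>i. i < ?n \<Longrightarrow> (\<Sum>j<?n. \<sigma> $$ (i, j) * \<psi> j) = of_real (1 - \<epsilon>) * \<psi> i"
    using lambda_max_eigenvector[OF d ab] lm by metis
  have q\<psi>: "Re (qform {..<?n} (\<lambda>i j. \<sigma> $$ (i, j)) \<psi>) = 1 - \<epsilon>"
    using density_eigenvalue_real(1)[OF d \<psi> ev] by simp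
  have \<epsilon>0: "0 \<le> \<epsilon>" using lambda_max_le_1[OF d ab] lm by simp
  \<comment> \<open>The condition m < 1 - \<epsilon> amounts to 2\<epsilon> < X^2, while m \<ge> 0
    follows from X^2 \<le> 1. Moreover (1 - \<epsilon>) m is still at least 1 - X^2, which is the
    target.\<close>
  define m where "m = 1 + \<epsilon> - X\<^sup>2"
  have m: "0 \<le> m" "m < 1 - \<epsilon>" using X \<epsilon>0 by (auto simp: m_def)
  \<comment> \<open>Existence by contraposition: no product vector of maximal overlap is
    constructed.\<close>
  then have "\<not> (\<forall>u w. (cmod (\<Sum>i<?n. cnj (product_vec b u w i) * \<psi> i))\<^sup>2 \<le> m * (norm2 {..<a} u * norm2 {..<b} w))"
    using ppt_product_overlap[OF \<sigma> m(1), of \<psi>] q\<psi> by auto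
  then obtain u w where uw: "m * (norm2 {..<a} u * norm2 {..<b} w) < (cmod (\<Sum>i<?n. cnj (product_vec b u w i) * \<psi> i))\<^sup>2"
    by (auto simp: not_le)
  define s where "s = norm2 {..<a} u"
  define t where "t = norm2 {..<b} w"
  have st: "0 \<le> s" "0 \<le> t" by (auto simp: s_def t_def intro!: sum_nonneg)
  have "(cmod (\<Sum>i<?n. cnj (product_vec b u w i) * \<psi> i))\<^sup>2 \<le> s * t"
    using cmod_sum_mult_le[of "\<lambda>i. cnj (product_vec b u w i)" \<psi> "{..<?n}"]
    by (simp add: \<psi> s_def t_def norm2_product_vec)
  \<comment> \<open>The overlap lies strictly above m s t and at most at s t, so s t = 0 would give
    0 < 0. Hence both factors can be normalized.\<close>
  then have "s * t \<noteq> 0" using uw by (auto simp: s_def[symmetric] t_def[symmetric])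
  then have st0: "0 < s" "0 < t" using st by auto
  define u' where "u' i = u i / of_real (sqrt s)" for i
  define w' where "w' i = w i / of_real (sqrt t)" for i
  have 1: "norm2 {..<a} u' = 1"
    using st0 by (simp add: u'_def norm_divide power_divide flip: sum_divide_distrib) (simp add: s_def)
  have 2: "norm2 {..<b} w' = 1"
    using st0 by (simp add: w'_def norm_divide power_divide flip: sum_divide_distrib) (simp add: t_def)
  have "product_vec b u' w' i = product_vec b u w i / of_real (sqrt (s * t))" for i
    by (simp add: product_vec_def u'_def w'_def real_sqrt_mult)
  then have "(\<Sum>i<?n. cnj (product_vec b u' w' i) * \<psi> i) =
      (\<Sum>i<?n. cnj (product_vec b u w i) * \<psi> i) / of_real (sqrt (s * t))"
    by (simp flip: sum_divide_distrib)
  then have "(cmod (\<Sum>i<?n. cnj (product_vec b u' w' i) * \<psi> i))\<^sup>2 =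
      (cmod (\<Sum>i<?n. cnj (product_vec b u w i) * \<psi> i))\<^sup>2 / (s * t)"
    using st0 by (simp add: norm_divide power_divide)
  also have "m \<le> \<dots>"
    using uw st0 by (simp add: pos_le_divide_eq s_def[symmetric] t_def[symmetric])
  finally have "(1 - \<epsilon>) * m \<le> (1 - \<epsilon>) * (cmod (\<Sum>i<?n. cnj (product_vec b u' w' i) * \<psi> i))\<^sup>2"
    using m by (intro mult_left_mono) auto
  also have "\<dots> \<le> Re (qform {..<?n} (\<lambda>i j. \<sigma> $$ (i, j)) (product_vec b u' w'))"
    using density_qform_ge_eigen[OF d \<psi> _ ev] m by simp
  finally have "(1 - \<epsilon>) * m \<le> Re (qform {..<?n} (\<lambda>i j. \<sigma> $$ (i, j)) (product_vec b u' w'))" .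
  moreover have "1 - X\<^sup>2 \<le> (1 - \<epsilon>) * m"
  proof -
    have "(1 - \<epsilon>) * m = 1 - X\<^sup>2 + \<epsilon> * (X\<^sup>2 - \<epsilon>)" by (simp add: m_def algebra_simps)
    moreover have "0 \<le> \<epsilon> * (X\<^sup>2 - \<epsilon>)" using \<epsilon>0 X by (intro mult_nonneg_nonneg) auto
    ultimately show ?thesis by linarith
  qed
  ultimately show ?thesis using 1 2 by (intro that[of u' w']) auto
qed

section \<open>LOCC channels on product vectors\<close>

abbreviation expval :: "complex mat \<Rightarrow> complex vec \<Rightarrow> complex" where
  "expval M w \<equiv> (M *\<^sub>v w) \<bullet>c w"

lemma mat_adjoint_dim [simp]: "dim_row (mat_adjoint A) = dim_col A" "dim_col (mat_adjoint A) = dim_row A"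
  by (simp_all add: mat_adjoint_def)

lemma mat_adjoint_index [simp]:
  "i < dim_col A \<Longrightarrow> j < dim_row A \<Longrightarrow> mat_adjoint A $$ (i, j) = conjugate (A $$ (j, i))"
  by (simp add: mat_adjoint_def mat_of_rows_index)

lemma mat_adjoint_carrier [simp]: "A \<in> carrier_mat n m \<Longrightarrow> mat_adjoint A \<in> carrier_mat m n"
  by (rule carrier_matI) (simp_all add: carrier_matD)

lemma mat_adjoint_one [simp]: "mat_adjoint (1\<^sub>m n :: complex mat) = 1\<^sub>m n"
  by (rule eq_matI) auto

lemma cscalar_prod_mat_adjoint:
  fixes A :: "complex mat"
  assumes "A \<in> carrier_mat m n" "x \<in> carrier_vec n" "y \<in> carrier_vec m"
  shows "(A *\<^sub>v x) \<bullet>c y = x \<bullet>c (mat_adjoint A *\<^sub>v y)"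
proof -
  have "(A *\<^sub>v x) \<bullet>c y = (\<Sum>i<m. \<Sum>j<n. A $$ (i, j) * x $ j * cnj (y $ i))"
    using assms by (auto simp: scalar_prod_def atLeast0LessThan sum_distrib_right intro!: sum.cong)
  also have "\<dots> = (\<Sum>j<n. \<Sum>i<m. A $$ (i, j) * x $ j * cnj (y $ i))"
    by (rule sum.swap)
  also have "\<dots> = x \<bullet>c (mat_adjoint A *\<^sub>v y)"
    using assms by (auto simp: scalar_prod_def atLeast0LessThan sum_distrib_left mult_ac intro!: sum.cong)
  finally show ?thesis .
qed

text \<open>The passage to the Heisenberg picture: the Kraus operator is moved from the state to the
  vector as its adjoint.\<close>

lemma expval_conj:
  assumes "K \<in> carrier_mat m n" "X \<in> carrier_mat n n" "w \<in> carrier_vec m"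
  shows "expval (K * X * mat_adjoint K) w = expval X (mat_adjoint K *\<^sub>v w)"
proof -
  have "(K * X * mat_adjoint K) *\<^sub>v w = K *\<^sub>v (X *\<^sub>v (mat_adjoint K *\<^sub>v w))"
    using assms by (simp add: assoc_mult_mat_vec[of _ m n _ n] assoc_mult_mat_vec[of "K * X" m n _ m]
        mult_carrier_mat[of K m n X n] mult_mat_vec_carrier[of _ n m])
  then show ?thesis
    using assms by (simp add: cscalar_prod_mat_adjoint[of K m n] mult_mat_vec_carrier[of _ n m] mult_mat_vec_carrier[of _ n n])
qed

lemma mat_sum_carrier [simp]: "mat_sum r c f I \<in> carrier_mat r c"
  by (simp add: mat_sum_def)

lemma expval_mat_sum:
  assumes "\<And>k. k \<in> I \<Longrightarrow> f k \<in> carrier_mat n n" "w \<in> carrier_vec n"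
  shows "expval (mat_sum n n f I) w = (\<Sum>k\<in>I. expval (f k) w)"
proof -
  have "expval (mat_sum n n f I) w = qform {..<n} (\<lambda>i j. mat_sum n n f I $$ (i, j)) (($) w)"
    using assms by (intro cscalar_prod_qform) auto
  also have "\<dots> = qform {..<n} (\<lambda>i j. \<Sum>k\<in>I. f k $$ (i, j)) (($) w)"
    by (rule qform_cong) (auto simp: mat_sum_def)
  also have "\<dots> = (\<Sum>i<n. \<Sum>j<n. \<Sum>k\<in>I. f k $$ (i, j) * w $ j * cnj (w $ i))"
    by (simp add: qform_def sum_distrib_right)
  also have "\<dots> = (\<Sum>i<n. \<Sum>k\<in>I. \<Sum>j<n. f k $$ (i, j) * w $ j * cnj (w $ i))"
    by (intro sum.cong refl sum.swap)
  also have "\<dots> = (\<Sum>k\<in>I. \<Sum>i<n. \<Sum>j<n. f k $$ (i, j) * w $ j * cnj (w $ i))"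
    by (rule sum.swap)
  also have "\<dots> = (\<Sum>k\<in>I. expval (f k) w)"
    unfolding qform_def[symmetric] using assms by (intro sum.cong refl cscalar_prod_qform[symmetric]) auto
  finally show ?thesis .
qed

lemma kraus_map_carrier [simp]: "kraus_map m Ks X \<in> carrier_mat m m"
  by (simp add: kraus_map_def)

lemma expval_kraus_map:
  assumes "set Ks \<subseteq> carrier_mat m n" "X \<in> carrier_mat n n" "w \<in> carrier_vec m"
  shows "expval (kraus_map m Ks X) w = (\<Sum>k<length Ks. expval X (mat_adjoint (Ks ! k) *\<^sub>v w))"
proof -
  have K: "Ks ! k \<in> carrier_mat m n" if "k < length Ks" for k using assms(1) that nth_mem by blast
  then have "Ks ! k * X * mat_adjoint (Ks ! k) \<in> carrier_mat m m" if "k < length Ks" for k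
    using assms(2) that by (meson mat_adjoint_carrier mult_carrier_mat)
  then have "expval (kraus_map m Ks X) w = (\<Sum>k<length Ks. expval (Ks ! k * X * mat_adjoint (Ks ! k)) w)"
    unfolding kraus_map_def using assms by (intro expval_mat_sum) auto
  then show ?thesis using expval_conj[OF K assms(2,3)] by simp
qed

section \<open>Tensor products of vectors and matrices\<close>

lemma tensor_vec_carrier [simp]:
  "u \<in> carrier_vec a \<Longrightarrow> v \<in> carrier_vec b \<Longrightarrow> tensor_vec u v \<in> carrier_vec (a * b)"
  by (rule carrier_vecI) (simp only: tensor_vec_def dim_vec carrier_vecD)

lemma tensor_vec_product_vec:
  "v \<in> carrier_vec b \<Longrightarrow> i < dim_vec u * b \<Longrightarrow> tensor_vec u v $ i = product_vec b (($) u) (($) v) i"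
  by (auto simp: tensor_vec_def product_vec_def)

lemma tensor_mat_carrier [simp]:
  "M \<in> carrier_mat m n \<Longrightarrow> N \<in> carrier_mat p q \<Longrightarrow> tensor_mat M N \<in> carrier_mat (m * p) (n * q)"
  by (rule carrier_matI) (simp_all only: tensor_mat_def dim_row_mat dim_col_mat carrier_matD)

lemma mod_less_mult: "i < a * b \<Longrightarrow> i mod b < (b::nat)"
  by (cases "b = 0") auto

lemma tensor_mat_index:
  assumes "M \<in> carrier_mat m n" "N \<in> carrier_mat p q" "i < m * p" "j < n * q"
  shows "tensor_mat M N $$ (i, j) = M $$ (i div p, j div q) * N $$ (i mod p, j mod q)"
  using assms by (simp add: tensor_mat_def)

lemma tensor_mat_mult_vec:
  assumes M: "M \<in> carrier_mat m n" and N: "N \<in> carrier_mat p q"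
    and u: "u \<in> carrier_vec n" and v: "v \<in> carrier_vec q"
  shows "tensor_mat M N *\<^sub>v tensor_vec u v = tensor_vec (M *\<^sub>v u) (N *\<^sub>v v)"
proof (rule eq_vecI)
  note T = tensor_mat_carrier[OF M N]
  note Mu = mult_mat_vec_carrier[OF M u] and Nv = mult_mat_vec_carrier[OF N v]
  fix i assume "i < dim_vec (tensor_vec (M *\<^sub>v u) (N *\<^sub>v v))"
  then have i: "i < m * p" using carrier_vecD[OF tensor_vec_carrier[OF Mu Nv]] by simp
  note i' = less_mult_imp_div_less[OF i] mod_less_mult[OF i]
  have "(tensor_mat M N *\<^sub>v tensor_vec u v) $ i = (\<Sum>k<n * q. tensor_mat M N $$ (i, k) * tensor_vec u v $ k)"
    using T tensor_vec_carrier[OF u v] i by (simp add: scalar_prod_def atLeast0LessThan)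
  also have "\<dots> = (\<Sum>k<n. \<Sum>l<q. (M $$ (i div p, k) * u $ k) * (N $$ (i mod p, l) * v $ l))"
    unfolding sum_lessThan_mult
  proof (intro sum.cong refl)
    fix k l assume kl: "k \<in> {..<n}" "l \<in> {..<q}"
    then have "k * q + l < n * q" by (simp add: index_lt)
    then show "tensor_mat M N $$ (i, k * q + l) * tensor_vec u v $ (k * q + l) =
        (M $$ (i div p, k) * u $ k) * (N $$ (i mod p, l) * v $ l)"
      using kl u tensor_mat_index[OF M N i] tensor_vec_product_vec[OF v, of _ u] by simp
  qed
  also have "\<dots> = (M *\<^sub>v u) $ (i div p) * (N *\<^sub>v v) $ (i mod p)"
    using M N u v i' by (simp add: scalar_prod_def sum_product atLeast0LessThan)
  also have "\<dots> = tensor_vec (M *\<^sub>v u) (N *\<^sub>v v) $ i"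
    using carrier_matD[OF M] tensor_vec_product_vec[OF Nv, of i "M *\<^sub>v u"] i by (simp add: product_vec_def)
  finally show "(tensor_mat M N *\<^sub>v tensor_vec u v) $ i = tensor_vec (M *\<^sub>v u) (N *\<^sub>v v) $ i" .
qed (use M N in \<open>simp add: tensor_mat_def tensor_vec_def\<close>)

lemma tensor_mat_mult:
  assumes M: "M \<in> carrier_mat m n" and N: "N \<in> carrier_mat p q"
    and P: "P \<in> carrier_mat n r" and Q: "Q \<in> carrier_mat q s"
  shows "tensor_mat M N * tensor_mat P Q = tensor_mat (M * P) (N * Q)"
proof (rule eq_matI)
  note MN = tensor_mat_carrier[OF M N] and PQ = tensor_mat_carrier[OF P Q]
  note MP = mult_carrier_mat[OF M P] and NQ = mult_carrier_mat[OF N Q]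
  fix i j assume "i < dim_row (tensor_mat (M * P) (N * Q))" "j < dim_col (tensor_mat (M * P) (N * Q))"
  then have i: "i < m * p" and j: "j < r * s" using carrier_matD[OF tensor_mat_carrier[OF MP NQ]] by simp_all
  note ij = less_mult_imp_div_less[OF i] mod_less_mult[OF i] less_mult_imp_div_less[OF j] mod_less_mult[OF j]
  have "(tensor_mat M N * tensor_mat P Q) $$ (i, j) = (\<Sum>k<n * q. tensor_mat M N $$ (i, k) * tensor_mat P Q $$ (k, j))"
    using MN PQ i j by (simp add: scalar_prod_def atLeast0LessThan)
  also have "\<dots> = (\<Sum>k<n. \<Sum>l<q. (M $$ (i div p, k) * P $$ (k, j div s)) * (N $$ (i mod p, l) * Q $$ (l, j mod s)))"
    unfolding sum_lessThan_mult
  proof (intro sum.cong refl)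
    fix k l assume kl: "k \<in> {..<n}" "l \<in> {..<q}"
    then have "k * q + l < n * q" by (simp add: index_lt)
    then show "tensor_mat M N $$ (i, k * q + l) * tensor_mat P Q $$ (k * q + l, j) =
        (M $$ (i div p, k) * P $$ (k, j div s)) * (N $$ (i mod p, l) * Q $$ (l, j mod s))"
      using kl tensor_mat_index[OF M N i] tensor_mat_index[OF P Q _ j] by simp
  qed
  also have "\<dots> = (M * P) $$ (i div p, j div s) * (N * Q) $$ (i mod p, j mod s)"
    using M N P Q ij by (simp add: scalar_prod_def sum_product atLeast0LessThan)
  also have "\<dots> = tensor_mat (M * P) (N * Q) $$ (i, j)"
    by (rule tensor_mat_index[OF MP NQ i j, symmetric])
  finally show "(tensor_mat M N * tensor_mat P Q) $$ (i, j) = tensor_mat (M * P) (N * Q) $$ (i, j)" .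
qed (use M N P Q in \<open>simp_all add: tensor_mat_def\<close>)

lemma mat_adjoint_tensor_mat:
  "mat_adjoint (tensor_mat M N) = tensor_mat (mat_adjoint M) (mat_adjoint N)"
proof (rule eq_matI)
  fix i j assume "i < dim_row (tensor_mat (mat_adjoint M) (mat_adjoint N))"
    and "j < dim_col (tensor_mat (mat_adjoint M) (mat_adjoint N))"
  then have i: "i < dim_col M * dim_col N" and j: "j < dim_row M * dim_row N"
    by (simp_all add: tensor_mat_def)
  note less_mult_imp_div_less[OF i] mod_less_mult[OF i] less_mult_imp_div_less[OF j] mod_less_mult[OF j]
  with i j show "mat_adjoint (tensor_mat M N) $$ (i, j) = tensor_mat (mat_adjoint M) (mat_adjoint N) $$ (i, j)"
    by (simp add: tensor_mat_def)
qed (simp_all add: tensor_mat_def)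

lemma tensor_mat_one: "tensor_mat (1\<^sub>m a) (1\<^sub>m b) = 1\<^sub>m (a * b)"
proof (rule eq_matI)
  fix i j assume ij: "i < dim_row (1\<^sub>m (a * b) :: complex mat)" "j < dim_col (1\<^sub>m (a * b) :: complex mat)"
  then have "i < a * b" "j < a * b" by simp_all
  note this[THEN less_mult_imp_div_less] this[THEN mod_less_mult]
  moreover have "i = j \<longleftrightarrow> i div b = j div b \<and> i mod b = j mod b"
    by (metis div_mult_mod_eq[of i b] div_mult_mod_eq[of j b])
  ultimately show "tensor_mat (1\<^sub>m a) (1\<^sub>m b) $$ (i, j) = (1\<^sub>m (a * b) :: complex mat) $$ (i, j)"
    using ij by (auto simp: tensor_mat_def)
qed (auto simp: tensor_mat_def)

text \<open>In the Heisenberg picture, an LOCC channel sends the expectation value at a product vector to such a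
  positive combination.\<close>

inductive sep :: "nat \<Rightarrow> nat \<Rightarrow> (complex mat \<Rightarrow> complex) \<Rightarrow> bool" for a b where
  sep_zero: "sep a b (\<lambda>X. 0)"
| sep_prod: "x \<in> carrier_vec a \<Longrightarrow> y \<in> carrier_vec b \<Longrightarrow> sep a b (\<lambda>X. expval X (tensor_vec x y))"
| sep_add: "sep a b g \<Longrightarrow> sep a b h \<Longrightarrow> sep a b (\<lambda>X. g X + h X)"
| sep_cong: "sep a b g \<Longrightarrow> (\<And>X. X \<in> carrier_mat (a * b) (a * b) \<Longrightarrow> h X = g X) \<Longrightarrow> sep a b h"

lemma sep_sum: "(\<And>i. i < n \<Longrightarrow> sep a b (g i)) \<Longrightarrow> sep a b (\<lambda>X. \<Sum>i<(n::nat). g i X)"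
  by (induction n) (auto intro: sep_zero sep_add)

text \<open>The adjoint of a local Kraus operator acts on one tensor factor only, so it maps product
  vectors to product vectors; several Kraus operators give a sum. The identity is established for
  matrices of the right size, and \<open>sep_cong\<close> passes from there to the functional
  itself.\<close>

lemma sep_kraus_alice:
  assumes "sep e b g" and Ks: "set Ks \<subseteq> carrier_mat e a"
  shows "sep a b (\<lambda>X. g (kraus_map (e * b) (map (\<lambda>K. tensor_mat K (1\<^sub>m b)) Ks) X))"
  using assms(1)
proof (induction rule: sep.induct)
  case (sep_prod x y)
  let ?Ks = "map (\<lambda>K. tensor_mat K (1\<^sub>m b)) Ks"
  have K: "Ks ! k \<in> carrier_mat e a" if "k < length Ks" for k using Ks that nth_mem by blast
  have "mat_adjoint (?Ks ! k) *\<^sub>v tensor_vec x y = tensor_vec (mat_adjoint (Ks ! k) *\<^sub>v x) y"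
    if "k < length Ks" for k
    using tensor_mat_mult_vec[of "mat_adjoint (Ks ! k)" a e "1\<^sub>m b" b b x y] K[OF that] sep_prod that
    by (simp add: mat_adjoint_tensor_mat)
  moreover have "set ?Ks \<subseteq> carrier_mat (e * b) (a * b)" using Ks by (auto intro!: tensor_mat_carrier)
  ultimately have "expval (kraus_map (e * b) ?Ks X) (tensor_vec x y) =
      (\<Sum>k<length Ks. expval X (tensor_vec (mat_adjoint (Ks ! k) *\<^sub>v x) y))"
    if "X \<in> carrier_mat (a * b) (a * b)" for X
    using expval_kraus_map[of ?Ks "e * b" "a * b" X "tensor_vec x y"] that sep_prod by simp
  moreover have "sep a b (\<lambda>X. \<Sum>k<length Ks. expval X (tensor_vec (mat_adjoint (Ks ! k) *\<^sub>v x) y))"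
    using K sep_prod by (intro sep_sum sep.sep_prod mult_mat_vec_carrier[of _ a e]) auto
  ultimately show ?case by (rule sep_cong[rotated])
next
  case (sep_cong g h)
  show ?case by (rule sep.sep_cong[OF sep_cong.IH]) (use sep_cong.hyps in simp)
qed (auto intro: sep.intros)

lemma sep_kraus_bob:
  assumes "sep a e g" and Ks: "set Ks \<subseteq> carrier_mat e b"
  shows "sep a b (\<lambda>X. g (kraus_map (a * e) (map (\<lambda>K. tensor_mat (1\<^sub>m a) K) Ks) X))"
  using assms(1)
proof (induction rule: sep.induct)
  case (sep_prod x y)
  let ?Ks = "map (\<lambda>K. tensor_mat (1\<^sub>m a) K) Ks"
  have K: "Ks ! k \<in> carrier_mat e b" if "k < length Ks" for k using Ks that nth_mem by blast
  have "mat_adjoint (?Ks ! k) *\<^sub>v tensor_vec x y = tensor_vec x (mat_adjoint (Ks ! k) *\<^sub>v y)"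
    if "k < length Ks" for k
    using tensor_mat_mult_vec[of "1\<^sub>m a" a a "mat_adjoint (Ks ! k)" b e x y] K[OF that] sep_prod that
    by (simp add: mat_adjoint_tensor_mat)
  moreover have "set ?Ks \<subseteq> carrier_mat (a * e) (a * b)" using Ks by (auto intro!: tensor_mat_carrier)
  ultimately have "expval (kraus_map (a * e) ?Ks X) (tensor_vec x y) =
      (\<Sum>k<length Ks. expval X (tensor_vec x (mat_adjoint (Ks ! k) *\<^sub>v y)))"
    if "X \<in> carrier_mat (a * b) (a * b)" for X
    using expval_kraus_map[of ?Ks "a * e" "a * b" X "tensor_vec x y"] that sep_prod by simp
  moreover have "sep a b (\<lambda>X. \<Sum>k<length Ks. expval X (tensor_vec x (mat_adjoint (Ks ! k) *\<^sub>v y)))"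
    using K sep_prod by (intro sep_sum sep.sep_prod mult_mat_vec_carrier[of _ b e]) auto
  ultimately show ?case by (rule sep_cong[rotated])
next
  case (sep_cong g h)
  show ?case by (rule sep.sep_cong[OF sep_cong.IH]) (use sep_cong.hyps in simp)
qed (auto intro: sep.intros)

lemma locc_carrier:
  "locc a' b' a b \<Lambda> \<Longrightarrow> X \<in> carrier_mat (a * b) (a * b) \<Longrightarrow> \<Lambda> X \<in> carrier_mat (a' * b') (a' * b')"
  by (induction rule: locc.induct) simp_all

text \<open>The vectors at the output stay fixed while the input dimensions vary along the protocol.
  The remaining protocol after each outcome yields a functional in \<open>sep\<close> by induction;
  the first round pulls it back through its local Kraus operators and sums over the
  outcomes.\<close>

lemma locc_sep:
  assumes "locc a' b' a b \<Lambda>" and u: "u \<in> carrier_vec a'" and v: "v \<in> carrier_vec b'"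
  shows "sep a b (\<lambda>X. expval (\<Lambda> X) (tensor_vec u v))"
  using assms(1)
proof (induction rule: locc.induct)
  case finish
  show ?case using u v by (rule sep_prod)
next
  case (alice a n e Ks b \<Lambda>)
  let ?k = "\<lambda>i. kraus_map (e i * b) (map (\<lambda>K. tensor_mat K (1\<^sub>m b)) (Ks i))"
  have "set (Ks i) \<subseteq> carrier_mat (e i) a" if "i < n" for i
    using alice.hyps(1) that unfolding instrument_def by blast
  then have sep: "sep a b (\<lambda>X. \<Sum>i<n. expval (\<Lambda> i (?k i X)) (tensor_vec u v))"
    by (intro sep_sum sep_kraus_alice alice.IH)
  have "\<Lambda> i (?k i X) \<in> carrier_mat (a' * b') (a' * b')" if "i \<in> {..<n}" for i X
    using that by (intro locc_carrier[OF alice.hyps(2)] kraus_map_carrier) simp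
  then show ?case
    by (intro sep_cong[OF sep] expval_mat_sum tensor_vec_carrier u v)
next
  case (bob b n e Ks a \<Lambda>)
  let ?k = "\<lambda>i. kraus_map (a * e i) (map (\<lambda>K. tensor_mat (1\<^sub>m a) K) (Ks i))"
  have "set (Ks i) \<subseteq> carrier_mat (e i) b" if "i < n" for i
    using bob.hyps(1) that unfolding instrument_def by blast
  then have sep: "sep a b (\<lambda>X. \<Sum>i<n. expval (\<Lambda> i (?k i X)) (tensor_vec u v))"
    by (intro sep_sum sep_kraus_bob bob.IH)
  have "\<Lambda> i (?k i X) \<in> carrier_mat (a' * b') (a' * b')" if "i \<in> {..<n}" for i X
    using that by (intro locc_carrier[OF bob.hyps(2)] kraus_map_carrier) simp
  then show ?case
    by (intro sep_cong[OF sep] expval_mat_sum tensor_vec_carrier u v)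
qed

section \<open>PPT operators representing separable functionals\<close>

lemma pos_semidefI:
  assumes "M \<in> carrier_mat n n" "\<And>v. 0 \<le> qform {..<n} (\<lambda>i j. M $$ (i, j)) v"
  shows "pos_semidef n M"
  unfolding pos_semidef_def using assms by (metis cscalar_prod_qform)

lemma pos_semidef_rank1:
  "pos_semidef n (mat n n (\<lambda>(i, j). z i * cnj (z j)))"
proof (rule pos_semidefI)
  fix v
  \<comment> \<open>A factorization with a single factor, indexed by the unit type.\<close>
  have "qform {..<n} (\<lambda>i j. mat n n (\<lambda>(i, j). z i * cnj (z j)) $$ (i, j)) v =
      of_real (norm2 {()} (\<lambda>k. \<Sum>i<n. cnj (z i) * v i))"
    by (rule qform_factor) auto
  then show "0 \<le> qform {..<n} (\<lambda>i j. mat n n (\<lambda>(i, j). z i * cnj (z j)) $$ (i, j)) v"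
    by (simp add: less_eq_complex_def)
qed simp

lemma pos_semidef_add:
  assumes "pos_semidef n M" "pos_semidef n N"
  shows "pos_semidef n (M + N)"
proof (rule pos_semidefI)
  fix v
  have "qform {..<n} (\<lambda>i j. (M + N) $$ (i, j)) v =
      qform {..<n} (\<lambda>i j. M $$ (i, j)) v + qform {..<n} (\<lambda>i j. N $$ (i, j)) v"
    using assms unfolding qform_def sum.distrib[symmetric]
    by (intro sum.cong refl) (auto simp: pos_semidef_def algebra_simps)
  then show "0 \<le> qform {..<n} (\<lambda>i j. (M + N) $$ (i, j)) v"
    using pos_semidef_qform[OF assms(1), of v] pos_semidef_qform[OF assms(2), of v] by simp
qed (use assms in \<open>auto simp: pos_semidef_def\<close>)

lemma partial_transpose_index [simp]:
  "i < a * b \<Longrightarrow> j < a * b \<Longrightarrow>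
    partial_transpose a b M $$ (i, j) = M $$ (i div b * b + j mod b, j div b * b + i mod b)"
  by (simp add: partial_transpose_def)

lemma partial_transpose_index_lt:
  "i < a * b \<Longrightarrow> j < a * b \<Longrightarrow> i div b * b + j mod b < a * (b::nat)"
  by (intro index_lt less_mult_imp_div_less mod_less_mult)

lemma partial_transpose_add:
  assumes "M \<in> carrier_mat (a * b) (a * b)" "N \<in> carrier_mat (a * b) (a * b)"
  shows "partial_transpose a b (M + N) = partial_transpose a b M + partial_transpose a b N"
  using assms by (intro eq_matI) (auto simp: partial_transpose_def partial_transpose_index_lt)

lemma mat_trace_add:
  "M \<in> carrier_mat n n \<Longrightarrow> N \<in> carrier_mat n n \<Longrightarrow> mat_trace (M + N) = mat_trace M + mat_trace N"
  by (simp add: mat_trace_def sum.distrib)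

text \<open>The representing operator is a sum of operators zz* with z a product of x and y. Partial
  transposition replaces y by its entrywise conjugate, so each summand stays positive of rank at
  most one.\<close>

lemma sep_ppt:
  assumes "sep a b g"
  shows "\<exists>\<tau>. pos_semidef (a * b) \<tau> \<and> pos_semidef (a * b) (partial_transpose a b \<tau>) \<and>
    (\<forall>X \<in> carrier_mat (a * b) (a * b). g X = mat_trace (X * \<tau>))"
  using assms
proof (induction rule: sep.induct)
  case sep_zero
  have "pos_semidef (a * b) (0\<^sub>m (a * b) (a * b))"
    by (rule pos_semidefI) (auto simp: qform_def)
  moreover have "partial_transpose a b (0\<^sub>m (a * b) (a * b)) = 0\<^sub>m (a * b) (a * b)"
    by (rule eq_matI) (auto simp: partial_transpose_def partial_transpose_index_lt)
  ultimately show ?case by (intro exI[of _ "0\<^sub>m (a * b) (a * b)"]) (auto simp: mat_trace_def)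
next
  case (sep_prod x y)
  define z where "z = product_vec b (($) x) (($) y)"
  define \<tau> where "\<tau> = mat (a * b) (a * b) (\<lambda>(i, j). z i * cnj (z j))"
  have "partial_transpose a b \<tau> = mat (a * b) (a * b) (\<lambda>(i, j).
      product_vec b (($) x) (\<lambda>k. cnj (y $ k)) i * cnj (product_vec b (($) x) (\<lambda>k. cnj (y $ k)) j))"
  proof (rule eq_matI, goal_cases)
    case (1 i j)
    then have ij: "i < a * b" "j < a * b" by simp_all
    note this[THEN mod_less_mult]
    with ij show ?case
      by (simp add: partial_transpose_index_lt \<tau>_def z_def) (simp add: product_vec_def)
  qed (simp_all add: partial_transpose_def)
  then have "pos_semidef (a * b) \<tau>" "pos_semidef (a * b) (partial_transpose a b \<tau>)"
    unfolding \<tau>_def by (simp_all only: pos_semidef_rank1)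
  moreover have "expval X (tensor_vec x y) = mat_trace (X * \<tau>)" if "X \<in> carrier_mat (a * b) (a * b)" for X
  proof -
    have "expval X (tensor_vec x y) = qform {..<a * b} (\<lambda>i j. X $$ (i, j)) z"
      unfolding cscalar_prod_qform[OF that tensor_vec_carrier[OF sep_prod]]
      using sep_prod by (intro qform_cong) (auto simp: z_def tensor_vec_product_vec)
    also have "\<dots> = mat_trace (X * \<tau>)"
      using trace_mult_factor[of X "a * b" \<tau> "\<lambda>_. z" "{()}"] that by (simp add: \<tau>_def)
    finally show ?thesis .
  qed
  ultimately show ?case by blast
next
  case (sep_add g h)
  then obtain \<tau>1 \<tau>2 where
    1: "pos_semidef (a * b) \<tau>1" "pos_semidef (a * b) (partial_transpose a b \<tau>1)"
      "\<And>X. X \<in> carrier_mat (a * b) (a * b) \<Longrightarrow> g X = mat_trace (X * \<tau>1)" and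
    2: "pos_semidef (a * b) \<tau>2" "pos_semidef (a * b) (partial_transpose a b \<tau>2)"
      "\<And>X. X \<in> carrier_mat (a * b) (a * b) \<Longrightarrow> h X = mat_trace (X * \<tau>2)" by blast
  have c: "\<tau>1 \<in> carrier_mat (a * b) (a * b)" "\<tau>2 \<in> carrier_mat (a * b) (a * b)"
    using 1(1) 2(1) by (auto simp: pos_semidef_def)
  have "g X + h X = mat_trace (X * (\<tau>1 + \<tau>2))" if X: "X \<in> carrier_mat (a * b) (a * b)" for X
    unfolding 1(3)[OF X] 2(3)[OF X] mult_add_distrib_mat[OF X c]
    using X c mat_trace_add[OF mult_carrier_mat[OF X c(1)] mult_carrier_mat[OF X c(2)]] by simp
  then show ?case
    using pos_semidef_add[OF 1(1) 2(1)] pos_semidef_add[OF 1(2) 2(2)] partial_transpose_add[OF c]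
    by (intro exI[of _ "\<tau>1 + \<tau>2"]) simp
next
  case (sep_cong g h)
  from sep_cong.IH obtain \<tau> where "pos_semidef (a * b) \<tau>" "pos_semidef (a * b) (partial_transpose a b \<tau>)"
    "\<And>X. X \<in> carrier_mat (a * b) (a * b) \<Longrightarrow> g X = mat_trace (X * \<tau>)" by blast
  then show ?case using sep_cong.hyps(2) by (intro exI[of _ \<tau>]) simp
qed

section \<open>Local unitary channels\<close>

lemma cscalar_prod_sum:
  "u \<in> carrier_vec n \<Longrightarrow> v \<in> carrier_vec n \<Longrightarrow> u \<bullet>c v = (\<Sum>i<n. u $ i * cnj (v $ i))"
  by (simp add: scalar_prod_def atLeast0LessThan)

lemma cscalar_prod_self_norm2:
  assumes "u \<in> carrier_vec n"
  shows "u \<bullet>c u = of_real (norm2 {..<n} (($) u))"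
  unfolding cscalar_prod_sum[OF assms assms] of_real_sum complex_norm_square ..

lemma tensor_vec_norm:
  assumes u: "u \<in> carrier_vec a" and v: "v \<in> carrier_vec b"
  shows "tensor_vec u v \<bullet>c tensor_vec u v = (u \<bullet>c u) * (v \<bullet>c v)"
proof -
  have "norm2 {..<a * b} (($) (tensor_vec u v)) = norm2 {..<a * b} (product_vec b (($) u) (($) v))"
    using u by (intro sum.cong refl) (simp add: tensor_vec_product_vec[OF v])
  then show ?thesis
    unfolding cscalar_prod_self_norm2[OF u] cscalar_prod_self_norm2[OF v]
      cscalar_prod_self_norm2[OF tensor_vec_carrier[OF u v]] norm2_product_vec of_real_mult by simp
qed

text \<open>The complex Householder map $1 - h h^* / \langle h, z\rangle$ with $h = z - x$ is unitary without
  adjusting phases. If $\langle h, z\rangle = 0$ then $h = 0$, so the junk quotient is harmless.\<close>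

lemma unitary_transitive:
  assumes z: "z \<in> carrier_vec n" "z \<bullet>c z = 1" and x: "x \<in> carrier_vec n" "x \<bullet>c x = 1"
  obtains U :: "complex mat" where "U \<in> carrier_mat n n" "mat_adjoint U * U = 1\<^sub>m n" "U * mat_adjoint U = 1\<^sub>m n"
    "mat_adjoint U *\<^sub>v z = x"
proof -
  define h where "h i = z $ i - x $ i" for i
  define c where "c = (\<Sum>i<n. cnj (h i) * z $ i)"
  define V where "V = mat n n (\<lambda>(i, j). (if i = j then 1 else 0) - h i * cnj (h j) / c)"
  have V: "V \<in> carrier_mat n n" by (simp add: V_def)
  have zz: "(\<Sum>i<n. z $ i * cnj (z $ i)) = 1" and xx: "(\<Sum>i<n. x $ i * cnj (x $ i)) = 1"
    using z x cscalar_prod_sum by metis+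
  \<comment> \<open>Equal norms of z and x make the squared norm of h equal to twice the real part
    of c. Exactly this relation cancels the coefficient of h h* in the product of V with its
    adjoint.\<close>
  have hh: "(\<Sum>i<n. h i * cnj (h i)) = c + cnj c"
  proof -
    have "(\<Sum>i<n. h i * cnj (h i)) = (\<Sum>i<n. cnj (h i) * z $ i + h i * cnj (z $ i)
        - z $ i * cnj (z $ i) + x $ i * cnj (x $ i))"
      by (intro sum.cong refl) (simp add: h_def algebra_simps)
    also have "\<dots> = c + cnj c"
      unfolding sum.distrib sum_subtractf zz xx by (simp add: c_def)
    finally show ?thesis .
  qed
  have h0: "h i = 0" if "c = 0" "i < n" for i
  proof -
    have "complex_of_real (norm2 {..<n} h) = 0"
      unfolding of_real_sum complex_norm_square hh using that by simp
    then have "norm2 {..<n} h = 0" by (simp only: of_real_eq_0_iff)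
    then show ?thesis using that(2) by (subst (asm) sum_nonneg_eq_0_iff) auto
  qed
  have Vz: "V *\<^sub>v z = x"
  proof (rule eq_vecI)
    fix i assume "i < dim_vec x"
    then have i: "i < n" using x by simp
    have "(V *\<^sub>v z) $ i = (\<Sum>j<n. (if i = j then z $ j else 0) - h i / c * (cnj (h j) * z $ j))"
      using i z V by (auto simp: V_def scalar_prod_def atLeast0LessThan algebra_simps intro!: sum.cong)
    also have "\<dots> = z $ i - h i / c * c"
      unfolding sum_subtractf sum_distrib_left[symmetric] c_def[symmetric] using i by simp
    also have "\<dots> = x $ i"
      using h0[OF _ i] by (cases "c = 0") (auto simp: h_def)
    finally show "(V *\<^sub>v z) $ i = x $ i" .
  qed (use V x in simp)
  have VV: "V * mat_adjoint V = 1\<^sub>m n"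
  proof (rule eq_matI)
    fix i j assume "i < dim_row (1\<^sub>m n :: complex mat)" "j < dim_col (1\<^sub>m n :: complex mat)"
    then have ij: "i < n" "j < n" by simp_all
    have "(V * mat_adjoint V) $$ (i, j) = (\<Sum>k<n. V $$ (i, k) * cnj (V $$ (j, k)))"
      using ij V by (simp add: scalar_prod_def atLeast0LessThan)
    also have "\<dots> = (\<Sum>k<n. (if k = i then (if i = j then 1 else 0) - cnj (h j) * h k / cnj c else 0)
        - (if k = j then h i * cnj (h k) / c else 0) + h i * cnj (h j) / (c * cnj c) * (h k * cnj (h k)))"
      using ij by (intro sum.cong refl) (auto simp: V_def algebra_simps)
    also have "\<dots> = (if i = j then 1 else 0) - cnj (h j) * h i / cnj c - h i * cnj (h j) / c
        + h i * cnj (h j) / (c * cnj c) * (c + cnj c)"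
      unfolding sum.distrib sum_subtractf sum_distrib_left[symmetric] hh using ij by simp
    also have "\<dots> = (1\<^sub>m n :: complex mat) $$ (i, j)"
      using ij by (cases "c = 0") (auto simp: field_simps)
    finally show "(V * mat_adjoint V) $$ (i, j) = (1\<^sub>m n :: complex mat) $$ (i, j)" .
  qed (use V in simp_all)
  have VV': "mat_adjoint V * V = 1\<^sub>m n"
    using mat_mult_left_right_inverse[OF V mat_adjoint_carrier[OF V] VV] .
  \<comment> \<open>The Householder map \<open>V\<close> sends z to x, whereas the claim asks this
    of the adjoint of U; so U is the adjoint of V.\<close>
  have "mat_adjoint (mat_adjoint V) = V"
    by (rule eq_matI) (use V in auto)
  with V VV VV' Vz that[of "mat_adjoint V"] show ?thesis by simp
qed

lemma mat_sum_single:
  "f 0 \<in> carrier_mat n n \<Longrightarrow> mat_sum n n f {..<Suc 0} = f 0"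
  by (rule eq_matI) (auto simp: mat_sum_def)

lemma kraus_map_single:
  assumes "K \<in> carrier_mat n n" "X \<in> carrier_mat n n"
  shows "kraus_map n [K] X = K * X * mat_adjoint K"
  using mat_sum_single[of "\<lambda>k. [K] ! k * X * mat_adjoint ([K] ! k)" n] assms
  by (simp add: kraus_map_def mult_carrier_mat[of _ n n _ n])

lemma instrument_single:
  assumes "U \<in> carrier_mat n n" "mat_adjoint U * U = 1\<^sub>m n"
  shows "instrument n 1 (\<lambda>_. n) (\<lambda>_. [U])"
proof -
  have "mat_sum n n (\<lambda>k. mat_adjoint ([U] ! k) * ([U] ! k)) {..<Suc 0} = 1\<^sub>m n"
    using assms by (subst mat_sum_single) simp_all
  then have "mat_sum n n (\<lambda>i. mat_sum n n (\<lambda>k. mat_adjoint ([U] ! k) * ([U] ! k)) {..<Suc 0}) {..<Suc 0} = 1\<^sub>m n"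
    by (subst mat_sum_single) simp_all
  then show ?thesis using assms(1) by (simp add: instrument_def)
qed

lemma maximally_mixed_conj:
  assumes "K \<in> carrier_mat n n" "K * mat_adjoint K = 1\<^sub>m n"
  shows "K * maximally_mixed n * mat_adjoint K = maximally_mixed n"
proof -
  have "K * maximally_mixed n = (1 / of_nat n) \<cdot>\<^sub>m K"
    using assms(1) by (simp add: maximally_mixed_def mult_smult_distrib[of _ n n _ n])
  then show ?thesis
    using mult_smult_assoc_mat[OF assms(1) mat_adjoint_carrier[OF assms(1)]] assms(2)
    by (simp add: maximally_mixed_def)
qed

text \<open>A protocol of two rounds with one outcome each. The isometry equations make the rounds
  instruments, the co-isometry equations preserve the maximally mixed state.\<close>

lemma GLOCC_local_unitary:
  assumes U: "U \<in> carrier_mat a a" "mat_adjoint U * U = 1\<^sub>m a" "U * mat_adjoint U = 1\<^sub>m a"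
    and V: "V \<in> carrier_mat b b" "mat_adjoint V * V = 1\<^sub>m b" "V * mat_adjoint V = 1\<^sub>m b"
  obtains \<Lambda> where "\<Lambda> \<in> GLOCC a b"
    and "\<And>X u v. X \<in> carrier_mat (a * b) (a * b) \<Longrightarrow> u \<in> carrier_vec a \<Longrightarrow> v \<in> carrier_vec b \<Longrightarrow>
      expval (\<Lambda> X) (tensor_vec u v) = expval X (tensor_vec (mat_adjoint U *\<^sub>v u) (mat_adjoint V *\<^sub>v v))"
proof -
  let ?n = "a * b"
  define K L where "K = tensor_mat U (1\<^sub>m b)" and "L = tensor_mat (1\<^sub>m a) V"
  have K: "K \<in> carrier_mat ?n ?n" and L: "L \<in> carrier_mat ?n ?n"
    unfolding K_def L_def using U(1) V(1) by (auto intro!: tensor_mat_carrier)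
  define \<Lambda>B where "\<Lambda>B X = mat_sum ?n ?n (\<lambda>_. kraus_map ?n (map (\<lambda>K. tensor_mat (1\<^sub>m a) K) [V]) X) {..<1::nat}" for X
  define \<Lambda> where "\<Lambda> X = mat_sum ?n ?n (\<lambda>_. \<Lambda>B (kraus_map ?n (map (\<lambda>K. tensor_mat K (1\<^sub>m b)) [U]) X)) {..<1::nat}" for X
  have lB: "locc a b a b \<Lambda>B"
    unfolding \<Lambda>B_def by (rule locc.bob[OF instrument_single[OF V(1,2)], where \<Lambda> = "\<lambda>_ X. X"]) (rule locc.finish)
  have l: "locc a b a b \<Lambda>"
    unfolding \<Lambda>_def by (rule locc.alice[OF instrument_single[OF U(1,2)], where \<Lambda> = "\<lambda>_. \<Lambda>B"]) (rule lB)
  have \<Lambda>BX: "\<Lambda>B X = L * X * mat_adjoint L" if "X \<in> carrier_mat ?n ?n" for X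
  proof -
    have "\<Lambda>B X = mat_sum ?n ?n (\<lambda>_. kraus_map ?n [L] X) {..<Suc 0}"
      by (simp add: \<Lambda>B_def L_def)
    also have "\<dots> = kraus_map ?n [L] X" by (rule mat_sum_single[OF kraus_map_carrier])
    finally show ?thesis using kraus_map_single[OF L that] by simp
  qed
  have conj_c: "M * X * mat_adjoint M \<in> carrier_mat ?n ?n"
    if "M \<in> carrier_mat ?n ?n" "X \<in> carrier_mat ?n ?n" for M X :: "complex mat"
    using that by (meson mat_adjoint_carrier mult_carrier_mat)
  have \<Lambda>X: "\<Lambda> X = L * (K * X * mat_adjoint K) * mat_adjoint L" if X: "X \<in> carrier_mat ?n ?n" for X
  proof -
    have "\<Lambda> X = mat_sum ?n ?n (\<lambda>_. \<Lambda>B (K * X * mat_adjoint K)) {..<Suc 0}"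
      using kraus_map_single[OF K X] by (simp add: \<Lambda>_def K_def)
    also have "\<dots> = \<Lambda>B (K * X * mat_adjoint K)"
      by (rule mat_sum_single) (rule locc_carrier[OF lB conj_c[OF K X]])
    finally show ?thesis using \<Lambda>BX[OF conj_c[OF K X]] by simp
  qed
  have "K * mat_adjoint K = 1\<^sub>m ?n"
    unfolding K_def mat_adjoint_tensor_mat
    using tensor_mat_mult[OF U(1) one_carrier_mat mat_adjoint_carrier[OF U(1)] one_carrier_mat] U(3)
    by (simp add: tensor_mat_one)
  moreover have "L * mat_adjoint L = 1\<^sub>m ?n"
    unfolding L_def mat_adjoint_tensor_mat
    using tensor_mat_mult[OF one_carrier_mat V(1) one_carrier_mat mat_adjoint_carrier[OF V(1)]] V(3)
    by (simp add: tensor_mat_one)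
  moreover have "maximally_mixed ?n \<in> carrier_mat ?n ?n" by (simp add: maximally_mixed_def)
  ultimately have "\<Lambda> (maximally_mixed ?n) = maximally_mixed ?n"
    by (simp only: \<Lambda>X maximally_mixed_conj[OF K] maximally_mixed_conj[OF L])
  with l have "\<Lambda> \<in> GLOCC a b" by (simp add: GLOCC_def)
  moreover have "expval (\<Lambda> X) (tensor_vec u v) = expval X (tensor_vec (mat_adjoint U *\<^sub>v u) (mat_adjoint V *\<^sub>v v))"
    if X: "X \<in> carrier_mat ?n ?n" and u: "u \<in> carrier_vec a" and v: "v \<in> carrier_vec b" for X u v
  proof -
    note Vv = mult_mat_vec_carrier[OF mat_adjoint_carrier[OF V(1)] v]
    have 1: "mat_adjoint L *\<^sub>v tensor_vec u v = tensor_vec u (mat_adjoint V *\<^sub>v v)"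
      using tensor_mat_mult_vec[OF one_carrier_mat mat_adjoint_carrier[OF V(1)] u v] u
      by (simp add: L_def mat_adjoint_tensor_mat)
    have 2: "mat_adjoint K *\<^sub>v tensor_vec u (mat_adjoint V *\<^sub>v v) =
        tensor_vec (mat_adjoint U *\<^sub>v u) (mat_adjoint V *\<^sub>v v)"
      using tensor_mat_mult_vec[OF mat_adjoint_carrier[OF U(1)] one_carrier_mat u Vv] Vv
      by (simp add: K_def mat_adjoint_tensor_mat)
    show ?thesis
      unfolding \<Lambda>X[OF X] expval_conj[OF L conj_c[OF K X] tensor_vec_carrier[OF u v]] 1
        expval_conj[OF K X tensor_vec_carrier[OF u Vv]] 2 ..
  qed
  ultimately show ?thesis by (rule that)
qed

section \<open>The PPT state dual to a GLOCC channel\<close>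

lemma mat_trace_smult: "M \<in> carrier_mat n n \<Longrightarrow> mat_trace (c \<cdot>\<^sub>m M) = c * mat_trace M"
  by (simp add: mat_trace_def sum_distrib_left)

text \<open>The trace of \<tau> is read off at the maximally mixed state: by unitality the
  expectation value there is 1/n for the unit product vector, while the representation gives the
  trace of \<tau> divided by n.\<close>

lemma GLOCC_ppt:
  assumes \<Lambda>: "\<Lambda> \<in> GLOCC a b" and ab: "0 < a * b"
    and u: "u \<in> carrier_vec a" "u \<bullet>c u = 1" and v: "v \<in> carrier_vec b" "v \<bullet>c v = 1"
  obtains \<tau> where "\<tau> \<in> PPT a b"
    and "\<And>X. X \<in> carrier_mat (a * b) (a * b) \<Longrightarrow> expval (\<Lambda> X) (tensor_vec u v) = mat_trace (X * \<tau>)"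
proof -
  let ?n = "a * b" and ?w = "tensor_vec u v"
  have l: "locc a b a b \<Lambda>" and mm: "\<Lambda> (maximally_mixed ?n) = maximally_mixed ?n"
    using \<Lambda> by (auto simp: GLOCC_def)
  from sep_ppt[OF locc_sep[OF l u(1) v(1)]] obtain \<tau> where
    \<tau>: "pos_semidef ?n \<tau>" "pos_semidef ?n (partial_transpose a b \<tau>)"
    and tr: "\<And>X. X \<in> carrier_mat ?n ?n \<Longrightarrow> expval (\<Lambda> X) ?w = mat_trace (X * \<tau>)" by blast
  have c: "\<tau> \<in> carrier_mat ?n ?n" using \<tau>(1) by (simp add: pos_semidef_def)
  have w: "?w \<in> carrier_vec ?n" by (rule tensor_vec_carrier[OF u(1) v(1)])
  have mmc: "maximally_mixed ?n \<in> carrier_mat ?n ?n" by (simp add: maximally_mixed_def)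
  have "expval (maximally_mixed ?n) ?w = 1 / of_nat ?n * (?w \<bullet>c ?w)"
  proof -
    have "maximally_mixed ?n $$ (i, j) * ?w $ j * cnj (?w $ i) =
        (if i = j then 1 / of_nat ?n * (?w $ j * cnj (?w $ j)) else 0)" if "i < ?n" "j < ?n" for i j
      using that by (simp add: maximally_mixed_def)
    then have "qform {..<?n} (\<lambda>i j. maximally_mixed ?n $$ (i, j)) (($) ?w) =
        (\<Sum>i<?n. \<Sum>j<?n. if i = j then 1 / of_nat ?n * (?w $ j * cnj (?w $ j)) else 0)"
      unfolding qform_def by (intro sum.cong refl) simp
    also have "\<dots> = (\<Sum>i<?n. 1 / of_nat ?n * (?w $ i * cnj (?w $ i)))"
      by (intro sum.cong refl) simp
    also have "\<dots> = 1 / of_nat ?n * (?w \<bullet>c ?w)"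
      unfolding sum_distrib_left[symmetric] cscalar_prod_sum[OF w w] ..
    finally show ?thesis
      using cscalar_prod_qform[OF _ w, of "maximally_mixed ?n"] by (simp add: maximally_mixed_def)
  qed
  then have "mat_trace (maximally_mixed ?n * \<tau>) = 1 / of_nat ?n"
    unfolding tr[OF mmc, unfolded mm, symmetric] tensor_vec_norm[OF u(1) v(1)] u(2) v(2) by simp
  moreover have "mat_trace (maximally_mixed ?n * \<tau>) = 1 / of_nat ?n * mat_trace \<tau>"
    unfolding maximally_mixed_def mult_smult_assoc_mat[OF one_carrier_mat c] left_mult_one_mat[OF c]
    by (rule mat_trace_smult[OF c])
  moreover have "of_nat ?n \<noteq> (0 :: complex)" using ab by (simp only: of_nat_eq_0_iff)
  moreover have "t = 1" if "s = 1 / N" "s = 1 / N * t" "N \<noteq> 0" for s t N :: complex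
    using that by simp
  ultimately have "mat_trace \<tau> = 1" by blast
  with \<tau> have "\<tau> \<in> PPT a b" unfolding PPT_def density_def by blast
  then show ?thesis using tr by (rule that)
qed

text \<open>A real supremum dominates its members only for a set bounded above; 1 is a bound for
  overlaps of states.\<close>

lemma bdd_above_trace_PPT:
  "density (a * b) \<rho> \<Longrightarrow> bdd_above ((\<lambda>\<tau>. Re (mat_trace (\<rho> * \<tau>))) ` PPT a b)"
  by (rule bdd_aboveI[of _ 1]) (auto simp: PPT_def trace_mult_density_le_1)

section \<open>The two bounds on \<open>F_max\<close>\<close>

context
  fixes a b :: nat and u v :: "complex vec" and \<rho> :: "complex mat"
  assumes u: "u \<in> carrier_vec a" "u \<bullet>c u = 1" and v: "v \<in> carrier_vec b" "v \<bullet>c v = 1"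
    and \<rho>: "density (a * b) \<rho>" and ab: "0 < a * b"
begin

lemma GLOCC_fidelity_le:
  assumes "\<Lambda> \<in> GLOCC a b"
  shows "Re (expval (\<Lambda> \<rho>) (tensor_vec u v)) \<le> (SUP \<tau>\<in>PPT a b. Re (mat_trace (\<rho> * \<tau>)))"
proof -
  obtain \<tau> where \<tau>: "\<tau> \<in> PPT a b"
    and e: "\<And>X. X \<in> carrier_mat (a * b) (a * b) \<Longrightarrow> expval (\<Lambda> X) (tensor_vec u v) = mat_trace (X * \<tau>)"
    using GLOCC_ppt[OF assms ab u v] by blast
  show ?thesis
    unfolding e[OF density_carrier[OF \<rho>]] by (rule cSUP_upper[OF \<tau> bdd_above_trace_PPT[OF \<rho>]])
qed

lemma F_max_le: "F_max a b u v \<rho> \<le> (SUP \<tau>\<in>PPT a b. Re (mat_trace (\<rho> * \<tau>)))"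
proof -
  \<comment> \<open>The identity channel makes the set nonempty, as \<open>cSUP_least\<close>
    demands.\<close>
  have "(\<lambda>X. X) \<in> GLOCC a b" by (simp add: GLOCC_def locc.finish)
  then show ?thesis unfolding F_max_def by (intro cSUP_least GLOCC_fidelity_le) auto
qed

text \<open>The PPT bound serves a second time: it is what makes the fidelities bounded above, so
  that each one lies below the supremum.\<close>

lemma F_max_ge: "\<Lambda> \<in> GLOCC a b \<Longrightarrow> Re (expval (\<Lambda> \<rho>) (tensor_vec u v)) \<le> F_max a b u v \<rho>"
  unfolding F_max_def
  by (intro cSUP_upper bdd_aboveI2[where M = "SUP \<tau>\<in>PPT a b. Re (mat_trace (\<rho> * \<tau>))"] GLOCC_fidelity_le) auto

lemma F_max_ge_product:
  assumes x: "x \<in> carrier_vec a" "x \<bullet>c x = 1" and y: "y \<in> carrier_vec b" "y \<bullet>c y = 1"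
  shows "Re (expval \<rho> (tensor_vec x y)) \<le> F_max a b u v \<rho>"
proof -
  obtain U where U: "U \<in> carrier_mat a a" "mat_adjoint U * U = 1\<^sub>m a" "U * mat_adjoint U = 1\<^sub>m a"
    "mat_adjoint U *\<^sub>v u = x" by (rule unitary_transitive[OF u x])
  obtain V where V: "V \<in> carrier_mat b b" "mat_adjoint V * V = 1\<^sub>m b" "V * mat_adjoint V = 1\<^sub>m b"
    "mat_adjoint V *\<^sub>v v = y" by (rule unitary_transitive[OF v y])
  obtain \<Lambda> where "\<Lambda> \<in> GLOCC a b"
    and "expval (\<Lambda> \<rho>) (tensor_vec u v) = expval \<rho> (tensor_vec x y)"
    using GLOCC_local_unitary[OF U(1-3) V(1-3)] density_carrier[OF \<rho>] u(1) v(1) U(4) V(4) by metis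
  then show ?thesis using F_max_ge by metis
qed

lemma F_max_nonneg: "0 \<le> F_max a b u v \<rho>"
proof -
  have "0 \<le> expval \<rho> (tensor_vec u v)"
    using \<rho> u(1) v(1) by (simp only: density_def pos_semidef_def tensor_vec_carrier)
  then have "0 \<le> Re (expval \<rho> (tensor_vec u v))" by (simp only: less_eq_complex_def) simp
  then show ?thesis using F_max_ge_product[OF u v] by linarith
qed

lemma trace_mult_PPT_le_F_max:
  assumes \<sigma>: "\<sigma> \<in> PPT a b" and lm: "lambda_max \<sigma> = 1 - \<epsilon>" and X: "0 < X" "2 * \<epsilon> < X\<^sup>2"
  shows "Re (mat_trace (\<rho> * \<sigma>)) \<le> F_max a b u v \<rho> + 2 * X"
proof (cases "X \<le> 1")
  case True
  then have "X\<^sup>2 \<le> 1" using X(1) by (simp add: power_le_one)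
  from ppt_product_fidelity[OF \<sigma> ab lm X(2) this] obtain p q where
    p: "norm2 {..<a} p = 1" and q: "norm2 {..<b} q = 1"
    and f: "1 - Re (qform {..<a * b} (\<lambda>i j. \<sigma> $$ (i, j)) (product_vec b p q)) \<le> X\<^sup>2" by blast
  define x y where "x = vec a p" and "y = vec b q"
  have x: "x \<in> carrier_vec a" and y: "y \<in> carrier_vec b" by (simp_all add: x_def y_def)
  have "x \<bullet>c x = 1" "y \<bullet>c y = 1"
    unfolding cscalar_prod_self_norm2[OF x] cscalar_prod_self_norm2[OF y] using p q by (simp_all add: x_def y_def)
  note xy = x this(1) y this(2)
  have "density (a * b) \<sigma>" using \<sigma> by (simp add: PPT_def)
  then have "Re (mat_trace (\<rho> * \<sigma>)) \<le> Re (qform {..<a * b} (\<lambda>i j. \<rho> $$ (i, j)) (product_vec b p q)) + 2 * X"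
    using trace_mult_le_qform[OF \<rho> _ _ X(1) f] norm2_product_vec[where a = a and b = b and u = p and w = q] p q by simp
  also have "qform {..<a * b} (\<lambda>i j. \<rho> $$ (i, j)) (product_vec b p q) = expval \<rho> (tensor_vec x y)"
    unfolding cscalar_prod_qform[OF density_carrier[OF \<rho>] tensor_vec_carrier[OF x y]]
  proof (rule qform_cong)
    fix i assume "i \<in> {..<a * b}"
    then have i: "i < a * b" by simp
    show "product_vec b p q i = tensor_vec x y $ i"
      using i less_mult_imp_div_less[OF i] mod_less_mult[OF i] tensor_vec_product_vec[OF y, of i x]
      by (simp add: x_def y_def product_vec_def)
  qed simp
  finally show ?thesis using F_max_ge_product[OF xy] by linarith
next
  case False
  \<comment> \<open>For X > 1 the claim is trivial: the trace is at most 1 and \<open>F_max\<close>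
    is nonnegative.\<close>
  have "density (a * b) \<sigma>" using \<sigma> by (simp add: PPT_def)
  from trace_mult_density_le_1[OF \<rho> this] F_max_nonneg False show ?thesis by linarith
qed

end

theorem proposition2:
  fixes dA dB :: nat and zeroA zeroB :: "complex vec"
    and \<rho> \<sigma> :: "complex mat" and \<delta> \<epsilon> :: real
  assumes "zeroA \<in> carrier_vec dA" and "zeroA \<bullet>c zeroA = 1"
    and "zeroB \<in> carrier_vec dB" and "zeroB \<bullet>c zeroB = 1"
    and "density (dA * dB) \<rho>"
    and "0 \<le> \<delta>"
    and "\<sigma> \<in> PPT dA dB"
    and "Re (mat_trace (\<rho> * \<sigma>)) \<ge> (SUP \<tau>\<in>PPT dA dB. Re (mat_trace (\<rho> * \<tau>))) - \<delta>"
    and "lambda_max \<sigma> = 1 - \<epsilon>"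
  shows "Re (mat_trace (\<rho> * \<sigma>)) + \<delta> \<ge> F_max dA dB zeroA zeroB \<rho> \<and>
    F_max dA dB zeroA zeroB \<rho> \<ge> Re (mat_trace (\<rho> * \<sigma>)) - 4 * sqrt \<epsilon>"
proof
  \<comment> \<open>In dimension 0 the inner product is an empty sum and cannot equal 1.\<close>
  have "dA \<noteq> 0" "dB \<noteq> 0"
    using assms(2,4) cscalar_prod_sum[OF assms(1,1)] cscalar_prod_sum[OF assms(3,3)] by (auto intro!: gr0I)
  then have d: "0 < dA * dB" by simp
  let ?F = "F_max dA dB zeroA zeroB \<rho>" and ?T = "Re (mat_trace (\<rho> * \<sigma>))"
  show "?F \<le> ?T + \<delta>"
    using F_max_le[OF assms(1-5) d] assms(8) by linarith
  have "density (dA * dB) \<sigma>" using assms(7) by (simp add: PPT_def)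
  \<comment> \<open>Only for \<epsilon> \<ge> 0 does \<open>sqrt \<epsilon>\<close> square to
    \<epsilon>.\<close>
  from lambda_max_le_1[OF this d] have \<epsilon>: "0 \<le> \<epsilon>" using assms(9) by simp
  \<comment> \<open>The slack \<open>\<eta>\<close> makes X = sqrt(2\<epsilon>) + \<eta>/2 satisfy
    the strict inequality 2\<epsilon> < X^2 and keeps X positive even when \<epsilon> = 0.\<close>
  have "?T \<le> ?F + 2 * (sqrt 2 * sqrt \<epsilon>) + \<eta>" if "0 < \<eta>" for \<eta>
  proof -
    have "2 * \<epsilon> = (sqrt 2 * sqrt \<epsilon>)\<^sup>2" using \<epsilon> by (simp add: power_mult_distrib)
    also have "\<dots> < (sqrt 2 * sqrt \<epsilon> + \<eta> / 2)\<^sup>2" using \<epsilon> that by (intro power_strict_mono) auto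
    finally have "?T \<le> ?F + 2 * (sqrt 2 * sqrt \<epsilon> + \<eta> / 2)"
      using \<epsilon> that by (intro trace_mult_PPT_le_F_max[OF assms(1-5) d assms(7,9)]) (auto intro: add_nonneg_pos)
    then show ?thesis by simp
  qed
  then have "?T \<le> ?F + 2 * (sqrt 2 * sqrt \<epsilon>)" by (rule field_le_epsilon)
  also have "sqrt 2 * sqrt \<epsilon> \<le> 2 * sqrt \<epsilon>"
    using \<epsilon> real_sqrt_le_mono[of 2 4] by (intro mult_right_mono) auto
  finally show "?T - 4 * sqrt \<epsilon> \<le> ?F" by simp
qed

end
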